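(* Let $\varphi=\varphi(t)$ be the Kuranishi data of a holomorphic family $\pi:\mathfrak{X}\to\Delta$ of compact complex manifolds with central fiber $X_0$ and nearby fibers $X_t$ ($t$ small). For every $\omega\in A^{0,q}(X_0)$, \begin{align*} d\big(e^{i_{\varphi}|i_{\overline{\varphi}}}(\omega)\big)=e^{i_{\varphi}|i_{\overline{\varphi}}}\Big(&(\mathbf{1}-\varphi\overline{\varphi})^{-1}\lrcorner\big(\partial\omega+\overline{\partial}(\overline{\varphi}\lrcorner\omega)-\overline{\varphi}\lrcorner\overline{\partial}\omega\big)\\ &+(\mathbf{1}-\overline{\varphi}\varphi)^{-1}\lrcorner\overline{\partial}\omega-q\,\overline{\partial}\omega-\big((\mathbf{1}-\overline{\varphi}\varphi)^{-1}\lrcorner\varphi\big)\lrcorner\big(\partial\omega+\overline{\partial}(\overline{\varphi}\lrcorner\omega)\big)\Big). \end{align*}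
   Context: Setting. $\pi:\mathfrak{X}\to\Delta$ is a holomorphic family of $n$-dimensional compact complex manifolds over a small disk $\Delta\subset\mathbb{C}$, with central fiber $X_0$ and fibers $X_t=\pi^{-1}(t)$. A transversely holomorphic trivialization $\mathfrak{X}\cong X_0\times\Delta$ is fixed, by which $X_t$ is identified with $X_0$ as a smooth manifold. It yields the Kuranishi data $\varphi=\varphi(t)\in A^{0,1}(X_0,T^{1,0}_{X_0})$, depending holomorphically on $t$, with $\varphi(0)=0$ and $\overline{\partial}\varphi=\frac12[\varphi,\varphi]$, where for $\phi=\sum\phi^i\otimes\partial/\partial z^i$, $\psi=\sum\psi^i\otimes\partial/\partial z^i$ in $A^{0,1}(X_0,T^{1,0}_{X_0})$ one has $[\phi,\psi]=\sum_{i,j}(\phi^i\wedge\partial_i\psi^j+\psi^i\wedge\partial_i\phi^j)\otimes\partial/\partial z^j$. In local holomorphic coordinates $z$ on $X_0$, write $\varphi=\sum\varphi^i_{\bar k}\,d\bar z^k\otimes\partial/\partial z^i$; the forms $e^{i_\varphi}(dz^i)=dz^i+\varphi^i_{\bar k}d\bar z^k$ are a local frame of $T^{*(1,0)}_{X_t}$ and their conjugates a local frame of $T^{*(0,1)}_{X_t}$. $t$ is small enough that the inverses below exist. $A^{p,q}$ denotes smooth complex $(p,q)$-forms; $\partial,\overline{\partial}$ are those of $X_0$; $d$ is the exterior derivative. Contraction. For a vector-valued form $\eta\otimes v$ ($\eta$ a form, $v$ a complex vector field), $(\eta\otimes v)\lrcorner\alpha=\eta\wedge(v\lrcorner\alpha)$,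 extended linearly (so contraction with a vector-valued $1$-form is a derivation of degree $0$; e.g. contracting a $(0,r)$-form with the identity $\sum d\bar z^i\otimes\partial/\partial\bar z^i$ multiplies it by $r$); $i_\varphi=\varphi\lrcorner$. If $\alpha$ is itself a vector-valued form, contraction acts on its form part. Exponentials. $e^{i_\varphi}=\sum_{k\ge0}\frac1{k!}i_\varphi^k$, and similarly $e^{i_{\overline{\varphi}}}$. The map $e^{i_{\varphi}|i_{\overline{\varphi}}}:A^{p,q}(X_0)\to A^{p,q}(X_t)$ sends $\omega=\sum\frac1{p!q!}\omega_{i_1\cdots i_p;j_1\cdots j_q}dz^{i_1}\wedge\cdots\wedge dz^{i_p}\wedge d\bar z^{j_1}\wedge\cdots\wedge d\bar z^{j_q}$ to $\sum\frac1{p!q!}\omega_{i_1\cdots i_p;j_1\cdots j_q}\,e^{i_\varphi}(dz^{i_1}\wedge\cdots\wedge dz^{i_p})\wedge e^{i_{\overline{\varphi}}}(d\bar z^{j_1}\wedge\cdots\wedge d\bar z^{j_q})$; it is extended additively to sums of forms of different types. Products. $\overline{\varphi}\varphi:=\varphi\lrcorner\overline{\varphi}=\sum\overline{\varphi}^{\bar i}_{k}\varphi^k_{\bar l}\,d\bar z^l\otimes\partial/\partial\bar z^i$ and $\varphi\overline{\varphi}:=\overline{\varphi}\lrcorner\varphi=\sum\varphi^i_{\bar k}\overline{\varphi}^{\bar k}_{l}\,dz^l\otimes\partial/\partial z^i$. $\mathbf{1}$ is the identity (of $T^{0,1}_{X_0}$ next to $\overline{\varphi}\varphi$, of $T^{1,0}_{X_0}$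 next to $\varphi\overline{\varphi}$); inverses are taken as endomorphisms, and the results are regarded as vector-valued $1$-forms. *)

theory Defs
  imports "HOL-Analysis.Analysis" "HOL-Library.Function_Algebras"
begin

section \<open>Exterior algebra in a coordinate frame\<close>

text \<open>
  In local coordinates \<open>z\<^sup>1, \<dots>, z\<^sup>n\<close> (indexed by the finite type \<open>'n\<close>) the complexified tangent
  space has the frame \<open>\<partial>/\<partial>z\<^sup>i\<close>, written \<open>Inl i\<close>, and the conjugate frame, written \<open>Inr i\<close>.
  A complex form at a point is the family of its values on lists of frame vectors, so
  \<open>\<alpha> (map Inl is @ map Inr js)\<close> is the coefficient with indices \<open>is; js\<close> of \<open>\<alpha>\<close>. A vector-valued
  form is the family of its components with respect to the frame.
\<close>

type_synonym 'n pform = "('n + 'n) list \<Rightarrow> complex"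
type_synonym 'n pvform = "'n + 'n \<Rightarrow> ('n + 'n) list \<Rightarrow> complex"

definition alternating :: "'n pform \<Rightarrow> bool" where
  "alternating \<alpha> \<longleftrightarrow>
     (\<forall>l i j. i < j \<and> j < length l \<longrightarrow> \<alpha> (l[i := l ! j, j := l ! i]) = - \<alpha> l)"

definition bidegree :: "nat \<Rightarrow> nat \<Rightarrow> 'n pform \<Rightarrow> bool" where
  "bidegree p q \<alpha> \<longleftrightarrow>
     (\<forall>l. \<alpha> l \<noteq> 0 \<longrightarrow>
        length (filter isl l) = p \<and> length (filter (\<lambda>a. \<not> isl a) l) = q)"

text \<open>
  The wedge product is the sum over shuffles without numerical factor, so that the value of
  \<open>dz\<^sup>1 \<and> dz\<^sup>2\<close> on \<open>\<partial>\<^sub>1, \<partial>\<^sub>2\<close> is 1. The exponent counts the inversions of the shuffle that puts the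
  positions in \<open>S\<close> first.
\<close>

definition wedge :: "'n pform \<Rightarrow> 'n pform \<Rightarrow> 'n pform" where
  "wedge \<alpha> \<beta> = (\<lambda>l. \<Sum>S\<in>Pow {..<length l}.
     (-1) ^ card {(i, j). j \<in> S \<and> i \<notin> S \<and> i < j} * \<alpha> (nths l S) * \<beta> (nths l (- S)))"

definition unit_form :: "'n pform" where
  "unit_form = (\<lambda>l. if l = [] then 1 else 0)"

definition coframe :: "'n + 'n \<Rightarrow> 'n pform" where
  "coframe a = (\<lambda>l. if l = [a] then 1 else 0)"

definition wedge_list :: "'n pform list \<Rightarrow> 'n pform" where
  "wedge_list \<alpha>s = foldr wedge \<alpha>s unit_form"

definition interior_product :: "'n + 'n \<Rightarrow> 'n pform \<Rightarrow> 'n pform" where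
  "interior_product b \<alpha> = (\<lambda>l. \<alpha> (b # l))"

definition pcontract :: "'n::finite pvform \<Rightarrow> 'n pform \<Rightarrow> 'n pform" where
  "pcontract K \<alpha> = (\<Sum>b\<in>UNIV. wedge (K b) (interior_product b \<alpha>))"

definition bar :: "'n + 'n \<Rightarrow> 'n + 'n" where
  "bar a = (case a of Inl i \<Rightarrow> Inr i | Inr i \<Rightarrow> Inl i)"

definition pconj :: "'n pvform \<Rightarrow> 'n pvform" where
  "pconj K = (\<lambda>b l. cnj (K (bar b) (map bar l)))"

text \<open>\<open>e\<^bsup>i\<^sub>K\<^esup>\<close>; for \<open>K\<close> of type \<open>A\<^sup>0\<^sup>,\<^sup>1(T\<^sup>1\<^sup>,\<^sup>0)\<close> or its conjugate only finitely many terms are nonzero.\<close>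

definition pexp :: "'n::finite pvform \<Rightarrow> 'n pform \<Rightarrow> 'n pform" where
  "pexp K \<alpha> = (\<lambda>l. \<Sum>k. (1 / fact k) * ((pcontract K ^^ k) \<alpha>) l)"

text \<open>
  The extension map \<open>e\<^bsup>i\<^sub>K | i\<^sub>L\<^esup>\<close> with \<open>L\<close> the conjugate of \<open>K\<close>. The sum over \<open>p\<close> and \<open>q\<close> is the
  additive extension to sums of forms of different types; bidegrees beyond the dimension do not occur.
\<close>

definition pextend :: "'n::finite pvform \<Rightarrow> 'n pform \<Rightarrow> 'n pform" where
  "pextend K \<omega> = (\<lambda>l.
     \<Sum>p\<le>CARD('n). \<Sum>q\<le>CARD('n).
       \<Sum>is | length is = p. \<Sum>js | length js = q.
         1 / (fact p * fact q) * \<omega> (map Inl is @ map Inr js) *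
         wedge (pexp K (wedge_list (map (\<lambda>i. coframe (Inl i)) is)))
               (pexp (pconj K) (wedge_list (map (\<lambda>j. coframe (Inr j)) js))) l)"

text \<open>
  Endomorphisms of \<open>T\<^sup>1\<^sup>,\<^sup>0\<close> and \<open>T\<^sup>0\<^sup>,\<^sup>1\<close> as vector-valued 1-forms: the matrix entry in row \<open>i\<close> and
  column \<open>j\<close> is the coefficient of \<open>dz\<^sup>j \<otimes> \<partial>/\<partial>z\<^sup>i\<close> (respectively of its conjugate).
\<close>

definition mat10 :: "'n pvform \<Rightarrow> complex ^ 'n ^ 'n" where
  "mat10 K = (\<chi> i j. K (Inl i) [Inl j])"

definition mat01 :: "'n pvform \<Rightarrow> complex ^ 'n ^ 'n" where
  "mat01 K = (\<chi> i j. K (Inr i) [Inr j])"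

definition of_mat10 :: "complex ^ 'n ^ 'n \<Rightarrow> 'n pvform" where
  "of_mat10 M = (\<lambda>b l. case (b, l) of (Inl i, [Inl j]) \<Rightarrow> M $ i $ j | _ \<Rightarrow> 0)"

definition of_mat01 :: "complex ^ 'n ^ 'n \<Rightarrow> 'n pvform" where
  "of_mat01 M = (\<lambda>b l. case (b, l) of (Inr i, [Inr j]) \<Rightarrow> M $ i $ j | _ \<Rightarrow> 0)"


section \<open>Calculus on \<open>\<complex>\<^sup>n\<close>\<close>

definition wirtinger ::
    "'n::finite + 'n \<Rightarrow> (complex ^ 'n \<Rightarrow> complex) \<Rightarrow> complex ^ 'n \<Rightarrow> complex" where
  "wirtinger a f z = (let D = frechet_derivative f (at z) in
     case a of
       Inl i \<Rightarrow> (D (axis i 1) - \<i> * D (axis i \<i>)) / 2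
     | Inr i \<Rightarrow> (D (axis i 1) + \<i> * D (axis i \<i>)) / 2)"

definition holomorphic_several :: "(complex ^ 'n::finite \<Rightarrow> complex) \<Rightarrow> (complex ^ 'n) set \<Rightarrow> bool" where
  "holomorphic_several f S \<longleftrightarrow>
     (\<forall>z\<in>S. f differentiable (at z) \<and> (\<forall>i. wirtinger (Inr i) f z = 0))"

fun Ck_on :: "nat \<Rightarrow> ('a::real_normed_vector \<Rightarrow> 'b::real_normed_vector) \<Rightarrow> 'a set \<Rightarrow> bool" where
  "Ck_on 0 f S = continuous_on S f"
| "Ck_on (Suc k) f S =
     ((\<forall>x\<in>S. f differentiable (at x)) \<and>
      (\<forall>v. Ck_on k (\<lambda>x. frechet_derivative f (at x) v) S))"

text \<open>Smoothness, only used for open \<open>S\<close> in finite-dimensional spaces.\<close>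

definition smooth_on :: "('a::real_normed_vector \<Rightarrow> 'b::real_normed_vector) \<Rightarrow> 'a set \<Rightarrow> bool" where
  "smooth_on f S \<longleftrightarrow> (\<forall>k. Ck_on k f S)"


section \<open>Complex manifolds\<close>

type_synonym ('a, 'n) chart = "'a set \<times> ('a \<Rightarrow> complex ^ 'n)"

definition is_chart :: "'a topology \<Rightarrow> ('a, 'n::finite) chart \<Rightarrow> bool" where
  "is_chart T = (\<lambda>(U, \<psi>).
     openin T U \<and> open (\<psi> ` U) \<and> homeomorphic_map (subtopology T U) (top_of_set (\<psi> ` U)) \<psi>)"

definition holomorphic_transition :: "('a, 'n::finite) chart \<Rightarrow> ('a, 'n) chart \<Rightarrow> bool" where
  "holomorphic_transition = (\<lambda>(U, \<psi>) (V, \<xi>).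
     \<forall>i. holomorphic_several (\<lambda>z. \<xi> (inv_into U \<psi> z) $ i) (\<psi> ` (U \<inter> V)))"

definition compatible :: "('a, 'n::finite) chart \<Rightarrow> ('a, 'n) chart \<Rightarrow> bool" where
  "compatible c c' \<longleftrightarrow> holomorphic_transition c c' \<and> holomorphic_transition c' c"

definition complex_manifold :: "'a topology \<Rightarrow> ('a, 'n::finite) chart set \<Rightarrow> bool" where
  "complex_manifold T A \<longleftrightarrow>
     Hausdorff_space T \<and> second_countable T \<and>
     (\<Union>(U, \<psi>)\<in>A. U) = topspace T \<and>
     (\<forall>c\<in>A. is_chart T c) \<and> (\<forall>c\<in>A. \<forall>c'\<in>A. compatible c c')"

definition max_atlas :: "'a topology \<Rightarrow> ('a, 'n::finite) chart set \<Rightarrow> ('a, 'n) chart set" where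
  "max_atlas T A = {c. is_chart T c \<and> (\<forall>c'\<in>A. compatible c c')}"

text \<open>The derivative of a function on the manifold along a frame vector of a chart.\<close>

definition chart_deriv ::
    "('a, 'n::finite) chart \<Rightarrow> 'n + 'n \<Rightarrow> ('a \<Rightarrow> complex) \<Rightarrow> 'a \<Rightarrow> complex" where
  "chart_deriv = (\<lambda>(U, \<psi>) a g x. wirtinger a (\<lambda>z. g (inv_into U \<psi> z)) (\<psi> x))"

text \<open>\<open>coord c (Inl i)\<close> is \<open>z\<^sup>i\<close> and \<open>coord c (Inr i)\<close> is its conjugate.\<close>

definition coord :: "('a, 'n::finite) chart \<Rightarrow> 'n + 'n \<Rightarrow> 'a \<Rightarrow> complex" where
  "coord = (\<lambda>(U, \<psi>) b x. case b of Inl i \<Rightarrow> \<psi> x $ i | Inr i \<Rightarrow> cnj (\<psi> x $ i))"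

definition jacobian ::
    "('a, 'n::finite) chart \<Rightarrow> ('a, 'n) chart \<Rightarrow> 'a \<Rightarrow> 'n + 'n \<Rightarrow> 'n + 'n \<Rightarrow> complex" where
  "jacobian c c' x b a = chart_deriv c' a (coord c b) x"


section \<open>Differential forms\<close>

text \<open>
  A form (vector-valued form) on a manifold is given by its coefficients at every point of every
  chart; only the values at points of the chart domain for charts of the atlas are meaningful.
\<close>

type_synonym ('a, 'n) form = "('a, 'n) chart \<Rightarrow> 'a \<Rightarrow> 'n pform"
type_synonym ('a, 'n) vform = "('a, 'n) chart \<Rightarrow> 'a \<Rightarrow> 'n pvform"

definition eq_on_atlas ::
    "('a, 'n::finite) chart set \<Rightarrow> (('a, 'n) chart \<Rightarrow> 'a \<Rightarrow> 'v) \<Rightarrow> (('a, 'n) chart \<Rightarrow> 'a \<Rightarrow> 'v) \<Rightarrow> bool" where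
  "eq_on_atlas A \<alpha> \<beta> \<longleftrightarrow> (\<forall>(U, \<psi>)\<in>A. \<forall>x\<in>U. \<alpha> (U, \<psi>) x = \<beta> (U, \<psi>) x)"

definition smooth_in_chart :: "('a, 'n::finite) chart \<Rightarrow> ('a \<Rightarrow> complex) \<Rightarrow> bool" where
  "smooth_in_chart = (\<lambda>(U, \<psi>) g. smooth_on (\<lambda>z. g (inv_into U \<psi> z)) (\<psi> ` U))"

definition forms :: "('a, 'n::finite) chart set \<Rightarrow> nat \<Rightarrow> nat \<Rightarrow> ('a, 'n) form set" where
  "forms A p q = {\<alpha>.
     (\<forall>c\<in>A. \<forall>x\<in>fst c. alternating (\<alpha> c x) \<and> bidegree p q (\<alpha> c x)) \<and>
     (\<forall>c\<in>A. \<forall>l. smooth_in_chart c (\<lambda>x. \<alpha> c x l)) \<and>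
     (\<forall>c\<in>A. \<forall>c'\<in>A. \<forall>x\<in>fst c \<inter> fst c'. \<forall>l.
        \<alpha> c' x l = (\<Sum>m | length m = length l.
          (\<Prod>j<length l. jacobian c c' x (m ! j) (l ! j)) * \<alpha> c x m))}"

definition vforms10 :: "('a, 'n::finite) chart set \<Rightarrow> nat \<Rightarrow> nat \<Rightarrow> ('a, 'n) vform set" where
  "vforms10 A p q = {\<phi>.
     (\<forall>c\<in>A. \<forall>x\<in>fst c. \<forall>b. alternating (\<phi> c x b) \<and> bidegree p q (\<phi> c x b)) \<and>
     (\<forall>c\<in>A. \<forall>x\<in>fst c. \<forall>i l. \<phi> c x (Inr i) l = 0) \<and>
     (\<forall>c\<in>A. \<forall>b l. smooth_in_chart c (\<lambda>x. \<phi> c x b l)) \<and>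
     (\<forall>c\<in>A. \<forall>c'\<in>A. \<forall>x\<in>fst c \<inter> fst c'. \<forall>b' l.
        \<phi> c' x b' l = (\<Sum>b\<in>UNIV. \<Sum>m | length m = length l.
          jacobian c' c x b' b * (\<Prod>j<length l. jacobian c c' x (m ! j) (l ! j)) * \<phi> c x b m))}"

text \<open>Derivative of all coefficients in the direction of a frame vector.\<close>

definition coeff_deriv :: "'n::finite + 'n \<Rightarrow> ('a, 'n) form \<Rightarrow> ('a, 'n) form" where
  "coeff_deriv a \<alpha> = (\<lambda>c x l. chart_deriv c a (\<lambda>y. \<alpha> c y l) x)"

definition del :: "('a, 'n::finite) form \<Rightarrow> ('a, 'n) form" where
  "del \<alpha> = (\<lambda>c x. \<Sum>i\<in>UNIV. wedge (coframe (Inl i)) (coeff_deriv (Inl i) \<alpha> c x))"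

definition delbar :: "('a, 'n::finite) form \<Rightarrow> ('a, 'n) form" where
  "delbar \<alpha> = (\<lambda>c x. \<Sum>i\<in>UNIV. wedge (coframe (Inr i)) (coeff_deriv (Inr i) \<alpha> c x))"

definition ext_deriv :: "('a, 'n::finite) form \<Rightarrow> ('a, 'n) form" where
  "ext_deriv \<alpha> = (\<lambda>c x. \<Sum>a\<in>UNIV. wedge (coframe a) (coeff_deriv a \<alpha> c x))"

definition contract :: "('a, 'n::finite) vform \<Rightarrow> ('a, 'n) form \<Rightarrow> ('a, 'n) form"
    (infixr \<open>\<rightharpoondown>\<close> 75) where
  "K \<rightharpoondown> \<alpha> = (\<lambda>c x. pcontract (K c x) (\<alpha> c x))"

definition vcontract :: "('a, 'n::finite) vform \<Rightarrow> ('a, 'n) vform \<Rightarrow> ('a, 'n) vform"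
    (infixr \<open>\<rightharpoondown>\<^sub>v\<close> 75) where
  "K \<rightharpoondown>\<^sub>v L = (\<lambda>c x b. pcontract (K c x) (L c x b))"

text \<open>The product \<open>K L\<close>, i.e. the composition of endomorphisms, is the contraction of \<open>K\<close> with \<open>L\<close>.\<close>

definition vprod :: "('a, 'n::finite) vform \<Rightarrow> ('a, 'n) vform \<Rightarrow> ('a, 'n) vform"
    (infixl \<open>\<bullet>\<^sub>v\<close> 76) where
  "K \<bullet>\<^sub>v L = L \<rightharpoondown>\<^sub>v K"

definition vconj :: "('a, 'n::finite) vform \<Rightarrow> ('a, 'n) vform" where
  "vconj K = (\<lambda>c x. pconj (K c x))"

definition form_scale :: "complex \<Rightarrow> ('a, 'n::finite) form \<Rightarrow> ('a, 'n) form" where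
  "form_scale k \<alpha> = (\<lambda>c x l. k * \<alpha> c x l)"

definition extend :: "('a, 'n::finite) vform \<Rightarrow> ('a, 'n) form \<Rightarrow> ('a, 'n) form" where
  "extend \<phi> \<omega> = (\<lambda>c x. pextend (\<phi> c x) (\<omega> c x))"

definition id10 :: "('a, 'n::finite) vform" where
  "id10 = (\<lambda>c x. of_mat10 (mat 1))"

definition id01 :: "('a, 'n::finite) vform" where
  "id01 = (\<lambda>c x. of_mat01 (mat 1))"

definition inverse10 :: "('a, 'n::finite) vform \<Rightarrow> ('a, 'n) vform" where
  "inverse10 K = (\<lambda>c x. of_mat10 (matrix_inv (mat10 (K c x))))"

definition inverse01 :: "('a, 'n::finite) vform \<Rightarrow> ('a, 'n) vform" where
  "inverse01 K = (\<lambda>c x. of_mat01 (matrix_inv (mat01 (K c x))))"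

definition vdelbar :: "('a, 'n::finite) vform \<Rightarrow> ('a, 'n) vform" where
  "vdelbar \<phi> = (\<lambda>c x b. delbar (\<lambda>c x. \<phi> c x b) c x)"

definition bracket :: "('a, 'n::finite) vform \<Rightarrow> ('a, 'n) vform \<Rightarrow> ('a, 'n) vform" where
  "bracket \<phi> \<psi> = (\<lambda>c x b. case b of
       Inl j \<Rightarrow> (\<Sum>i\<in>UNIV.
          wedge (\<phi> c x (Inl i)) (coeff_deriv (Inl i) (\<lambda>c x. \<psi> c x (Inl j)) c x)
        + wedge (\<psi> c x (Inl i)) (coeff_deriv (Inl i) (\<lambda>c x. \<phi> c x (Inl j)) c x))
     | Inr j \<Rightarrow> 0)"


section \<open>Holomorphic families and Kuranishi data\<close>

text \<open>
  The base is the disk of radius \<open>r\<close> about 0. The total space is a complex manifold of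
  dimension \<open>n + 1\<close>, whose coordinates are indexed by \<open>'n option\<close>; the projection is a proper
  surjective holomorphic submersion.
\<close>

definition holomorphic_family ::
    "'a topology \<Rightarrow> ('a, 'n::finite option) chart set \<Rightarrow> ('a \<Rightarrow> complex) \<Rightarrow> real \<Rightarrow> bool" where
  "holomorphic_family T A \<pi> r \<longleftrightarrow>
     r > 0 \<and> complex_manifold T A \<and>
     \<pi> ` topspace T = ball 0 r \<and>
     continuous_map T (top_of_set (ball 0 r)) \<pi> \<and>
     proper_map T (top_of_set (ball 0 r)) \<pi> \<and>
     (\<forall>(U, \<psi>)\<in>A. holomorphic_several (\<lambda>z. \<pi> (inv_into U \<psi> z)) (\<psi> ` U)) \<and>
     (\<forall>(U, \<psi>)\<in>A. \<forall>x\<in>U. \<exists>i. chart_deriv (U, \<psi>) (Inl i) \<pi> x \<noteq> 0)"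

definition fibre :: "'a topology \<Rightarrow> ('a \<Rightarrow> complex) \<Rightarrow> complex \<Rightarrow> 'a topology" where
  "fibre T \<pi> t = subtopology T {x \<in> topspace T. \<pi> x = t}"

text \<open>
  The submanifold structure of a fibre: restrict those holomorphic coordinates of the total space
  whose coordinate \<open>None\<close> is the projection.
\<close>

definition fibre_atlas ::
    "'a topology \<Rightarrow> ('a, 'n::finite option) chart set \<Rightarrow> ('a \<Rightarrow> complex) \<Rightarrow> complex \<Rightarrow> ('a, 'n) chart set" where
  "fibre_atlas T A \<pi> t = max_atlas (fibre T \<pi> t)
     {(U \<inter> {x. \<pi> x = t}, \<lambda>x. \<chi> i. \<psi> x $ Some i) | U \<psi>.
        (U, \<psi>) \<in> max_atlas T A \<and> (\<forall>x\<in>U. \<psi> x $ None = \<pi> x)}"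

text \<open>
  A trivialization is given by its projection \<open>\<sigma>\<close> to the central fibre; \<open>transport T \<pi> \<sigma> t\<close> is the
  induced identification of the central fibre with the fibre over \<open>t\<close>.
\<close>

definition transport :: "'a topology \<Rightarrow> ('a \<Rightarrow> complex) \<Rightarrow> ('a \<Rightarrow> 'a) \<Rightarrow> complex \<Rightarrow> 'a \<Rightarrow> 'a" where
  "transport T \<pi> \<sigma> t x = inv_into (topspace T) (\<lambda>y. (\<sigma> y, \<pi> y)) (x, t)"

definition transversely_holomorphic_trivialization ::
    "'a topology \<Rightarrow> ('a, 'n::finite option) chart set \<Rightarrow> ('a \<Rightarrow> complex) \<Rightarrow> real \<Rightarrow> ('a \<Rightarrow> 'a) \<Rightarrow> bool" where
  "transversely_holomorphic_trivialization T A \<pi> r \<sigma> \<longleftrightarrow>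
     homeomorphic_map T (prod_topology (fibre T \<pi> 0) (top_of_set (ball 0 r))) (\<lambda>y. (\<sigma> y, \<pi> y)) \<and>
     (\<forall>x\<in>topspace (fibre T \<pi> 0). \<sigma> x = x) \<and>
     (\<forall>(U, \<psi>)\<in>fibre_atlas T A \<pi> 0. \<forall>(V, \<xi>)\<in>A.
        smooth_on (\<lambda>w. \<psi> (\<sigma> (inv_into V \<xi> w))) (\<xi> ` {y\<in>V. \<sigma> y \<in> U}) \<and>
        smooth_on (\<lambda>(z, t). \<xi> (transport T \<pi> \<sigma> t (inv_into U \<psi> z)))
          {(z, t). z \<in> \<psi> ` U \<and> t \<in> ball 0 r \<and> transport T \<pi> \<sigma> t (inv_into U \<psi> z) \<in> V}) \<and>
     (\<forall>x\<in>topspace (fibre T \<pi> 0). \<forall>(V, \<xi>)\<in>A. \<forall>i.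
        (\<lambda>t. \<xi> (transport T \<pi> \<sigma> t x) $ i) holomorphic_on {t\<in>ball 0 r. transport T \<pi> \<sigma> t x \<in> V})"

text \<open>
  The last condition says that \<open>e\<^bsup>i\<^sub>\<phi>\<^esup>(dz\<^sup>i)\<close> is a frame of the (1,0)-forms of the fibre over \<open>t\<close>: these
  \<open>n\<close> forms, which are linearly independent, span the same space as the differentials of
  holomorphic coordinates \<open>w\<close> of that fibre, pulled back to the central fibre.
\<close>

definition kuranishi_data ::
    "'a topology \<Rightarrow> ('a, 'n::finite option) chart set \<Rightarrow> ('a \<Rightarrow> complex) \<Rightarrow> real \<Rightarrow> ('a \<Rightarrow> 'a) \<Rightarrow>
     (complex \<Rightarrow> ('a, 'n) vform) \<Rightarrow> bool" where
  "kuranishi_data T A \<pi> r \<sigma> \<phi> \<longleftrightarrow>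
     (let A0 = fibre_atlas T A \<pi> 0 in
       (\<forall>t\<in>ball 0 r. \<phi> t \<in> vforms10 A0 0 1) \<and>
       (\<forall>(U, \<psi>)\<in>A0. \<forall>x\<in>U. \<forall>b l. (\<lambda>t. \<phi> t (U, \<psi>) x b l) holomorphic_on ball 0 r) \<and>
       eq_on_atlas A0 (\<phi> 0) 0 \<and>
       (\<forall>t\<in>ball 0 r.
          eq_on_atlas A0 (vdelbar (\<phi> t)) (\<lambda>c x b l. 1 / 2 * bracket (\<phi> t) (\<phi> t) c x b l)) \<and>
       (\<forall>t\<in>ball 0 r. \<forall>(U, \<psi>)\<in>A0. \<forall>(V, w)\<in>fibre_atlas T A \<pi> t.
          \<forall>x\<in>U. transport T \<pi> \<sigma> t x \<in> V \<longrightarrow>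
            range (\<lambda>k :: complex ^ 'n. \<lambda>a. \<Sum>j\<in>UNIV.
              k $ j * chart_deriv (U, \<psi>) a (\<lambda>y. w (transport T \<pi> \<sigma> t y) $ j) x)
          = range (\<lambda>k :: complex ^ 'n. \<lambda>a. \<Sum>i\<in>UNIV.
              k $ i * pexp (\<phi> t (U, \<psi>) x) (coframe (Inl i)) [a])))"

text \<open>The condition that \<open>t\<close> is so small that the inverses occurring in the formula exist.\<close>

definition inverses_exist :: "('a, 'n::finite) chart set \<Rightarrow> ('a, 'n) vform \<Rightarrow> bool" where
  "inverses_exist A \<phi> \<longleftrightarrow>
     (\<forall>(U, \<psi>)\<in>A. \<forall>x\<in>U.
        invertible (mat10 ((id10 - \<phi> \<bullet>\<^sub>v vconj \<phi>) (U, \<psi>) x)) \<and>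
        invertible (mat01 ((id01 - vconj \<phi> \<bullet>\<^sub>v \<phi>) (U, \<psi>) x)))"

end

theory Submission
  imports Defs
begin

text \<open>
  In a chart, \<open>e\<^bsup>i\<^sub>\<phi>|i\<^sub>\<phi>\<^sub>-\<^esup>\<close> is the algebra endomorphism \<open>T\<close> of the exterior algebra induced by
  \<open>dz\<^sup>i \<mapsto> dz\<^sup>i + \<phi>\<^sup>i\<close> and its conjugate. Hence, with \<open>\<psi>\<close> the conjugate of \<open>\<phi>\<close>, the Leibniz rule gives
  \<open>d(T \<omega>) = \<Sum>\<^sub>a e\<^sup>a \<and> T(\<partial>\<^sub>a \<omega>) + \<Sum>\<^sub>j d\<psi>\<^sup>j \<and> T(\<iota>\<^sub>j \<omega>)\<close>, and conjugating the integrability condition turns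
  \<open>d\<psi>\<^sup>j\<close> into \<open>\<Sum>\<^sub>k T(dz\<^sup>k\<^sup>-) \<and> \<partial>\<^sub>k\<^sub>- \<psi>\<^sup>j\<close>. Every remaining \<open>e\<^sup>a\<close> is \<open>T\<close> of an explicit 1-form in which
  \<open>(1 - \<phi>\<psi>)\<^sup>-\<^sup>1\<close> and \<open>(1 - \<psi>\<phi>)\<^sup>-\<^sup>1\<close> occur, so both sides of the formula are \<open>T\<close> of the same form; this
  last comparison only uses \<open>(1 - \<phi>\<psi>)\<^sup>-\<^sup>1 \<phi> = \<phi> (1 - \<psi>\<phi>)\<^sup>-\<^sup>1\<close> and
  \<open>\<psi> \<phi> (1 - \<psi>\<phi>)\<^sup>-\<^sup>1 = (1 - \<psi>\<phi>)\<^sup>-\<^sup>1 - 1\<close>.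
\<close>

section \<open>The shuffle algebra\<close>

definition one_form :: "'n pform \<Rightarrow> bool" where
  "one_form \<kappa> \<longleftrightarrow> (\<forall>l. length l \<noteq> 1 \<longrightarrow> \<kappa> l = 0)"

definition scale :: "complex \<Rightarrow> 'n pform \<Rightarrow> 'n pform" where
  "scale k \<alpha> = (\<lambda>l. k * \<alpha> l)"

text \<open>The grading involution of the exterior algebra. It carries the Koszul sign in every
  degree at once, so that sign rules can be stated for forms of mixed degree.\<close>

definition parity :: "'n pform \<Rightarrow> 'n pform" where
  "parity \<alpha> = (\<lambda>l. (-1) ^ length l * \<alpha> l)"

lemma sum_fun_apply: "(\<Sum>i\<in>I. f i) x = (\<Sum>i\<in>I. f i x)"
  by (induction I rule: infinite_finite_induct) auto

lemma wedge_Nil [simp]: "wedge \<alpha> \<beta> [] = \<alpha> [] * \<beta> []"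
  by (simp add: wedge_def)

lemma Pow_lessThan_Suc:
  "Pow {..<Suc n} = (\<lambda>S. insert 0 (Suc ` S)) ` Pow {..<n} \<union> (\<lambda>S. Suc ` S) ` Pow {..<n}"
proof -
  have "{..<Suc n} = insert 0 (Suc ` {..<n})"
    using lessThan_Suc_eq_insert_0 by blast
  then show ?thesis
    by (simp add: Pow_insert image_Pow_surj [OF refl, symmetric] image_image Un_commute)
qed

text \<open>The graded Leibniz rule for the interior product, read off at an argument list. The
  first argument goes to one of the factors; if it goes to the second, it passes all arguments of
  the first, whence \<open>parity \<alpha>\<close>. Units, associativity and graded commutativity
  all follow from this recursion by induction on the list.\<close>

lemma wedge_Cons:
  "wedge \<alpha> \<beta> (b # l) = wedge (interior_product b \<alpha>) \<beta> l + wedge (parity \<alpha>) (interior_product b \<beta>) l"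
proof -
  let ?inv = "\<lambda>S::nat set. {(i, j). j \<in> S \<and> i \<notin> S \<and> i < j}"
  let ?f = "\<lambda>S. (-1) ^ card (?inv S) * \<alpha> (nths (b # l) S) * \<beta> (nths (b # l) (- S))"
  let ?A = "Pow {..<length l}"
  have inj1: "inj_on (\<lambda>S. insert 0 (Suc ` S)) ?A"
    by (rule inj_onI) (metis (no_types, lifting) image_iff inj_Suc inj_image_eq_iff insert_ident nat.distinct(1))
  have inj2: "inj_on (\<lambda>S. Suc ` S) ?A"
    by (rule inj_onI) (metis inj_Suc inj_image_eq_iff)
  have disj: "(\<lambda>S. insert 0 (Suc ` S)) ` ?A \<inter> (\<lambda>S. Suc ` S) ` ?A = {}"
    by auto
  have "wedge \<alpha> \<beta> (b # l) = sum ?f (Pow {..<Suc (length l)})"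
    by (simp add: wedge_def)
  also have "\<dots> = (\<Sum>S\<in>?A. ?f (insert 0 (Suc ` S))) + (\<Sum>S\<in>?A. ?f (Suc ` S))"
    unfolding Pow_lessThan_Suc
    by (subst sum.union_disjoint) (auto simp: disj sum.reindex [OF inj1] sum.reindex [OF inj2])
  also have "(\<Sum>S\<in>?A. ?f (insert 0 (Suc ` S))) = wedge (interior_product b \<alpha>) \<beta> l"
  proof -
    have "?f (insert 0 (Suc ` S)) = (-1) ^ card (?inv S) * \<alpha> (b # nths l S) * \<beta> (nths l (- S))" for S
    proof -
      \<comment> \<open>With 0 in the set, no inversion involves 0, so the inversions are only
        shifted by one.\<close>
      have "?inv (insert 0 (Suc ` S)) = map_prod Suc Suc ` ?inv S"
        by (auto simp: image_iff) (metis (no_types, lifting) gr0_implies_Suc not0_implies_Suc Suc_less_eq)+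
      then have "card (?inv (insert 0 (Suc ` S))) = card (?inv S)"
        by (simp add: card_image inj_on_subset [OF prod.inj_map [OF inj_Suc inj_Suc]])
      moreover have "{j. Suc j \<in> insert 0 (Suc ` S)} = S" "{j. Suc j \<in> - insert 0 (Suc ` S)} = - S"
        by auto
      ultimately show ?thesis
        by (simp add: nths_Cons)
    qed
    then show ?thesis
      by (simp add: wedge_def interior_product_def)
  qed
  also have "(\<Sum>S\<in>?A. ?f (Suc ` S)) = wedge (parity \<alpha>) (interior_product b \<beta>) l"
  proof -
    have "?f (Suc ` S) = (-1) ^ card (?inv S) * parity \<alpha> (nths l S) * \<beta> (b # nths l (- S))"
      if S: "S \<subseteq> {..<length l}" for S
    proof -
      have fin: "finite S"
        using S finite_subset by blast
      \<comment> \<open>Now 0 lies outside the set and precedes each of its elements. This makes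
        \<open>card S\<close> new inversions, the sign in \<open>parity \<alpha>\<close>, since the
        first factor receives \<open>card S\<close> arguments.\<close>
      have "?inv (Suc ` S) = map_prod Suc Suc ` ?inv S \<union> (\<lambda>j. (0, Suc j)) ` S"
        by (auto simp: image_iff) (metis (no_types, lifting) gr0_implies_Suc not0_implies_Suc Suc_less_eq)+
      moreover have "finite (?inv S)"
        by (rule finite_subset [of _ "{..<length l} \<times> {..<length l}"]) (use S in auto)
      moreover have "card (map_prod Suc Suc ` ?inv S) = card (?inv S)"
        by (simp add: card_image inj_on_subset [OF prod.inj_map [OF inj_Suc inj_Suc]])
      moreover have "card ((\<lambda>j. (0::nat, Suc j)) ` S) = card S"
        by (simp add: card_image inj_on_def)
      moreover have "map_prod Suc Suc ` ?inv S \<inter> (\<lambda>j. (0, Suc j)) ` S = {}"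
        by auto
      ultimately have "card (?inv (Suc ` S)) = card (?inv S) + card S"
        using fin by (simp add: card_Un_disjoint)
      moreover have "{j. Suc j \<in> Suc ` S} = S" "{j. Suc j \<in> - Suc ` S} = - S"
        by auto
      moreover have "length (nths l S) = card S"
        using S by (simp add: length_nths) (metis (no_types, lifting) Collect_cong Collect_mem_eq lessThan_iff subset_iff)
      ultimately show ?thesis
        by (simp add: nths_Cons parity_def power_add)
    qed
    then show ?thesis
      by (simp add: wedge_def interior_product_def)
  qed
  finally show ?thesis .
qed

abbreviation "ip \<equiv> interior_product"

text \<open>As simp rules these also rewrite unapplied sums of forms, by eta-expansion.\<close>

declare plus_fun_apply [simp del] zero_fun_apply [simp del]
lemmas pointwise = plus_fun_apply zero_fun_apply

section \<open>Sums over frames and index lists, and linearity of the operations\<close>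

lemma sum_UNIV_Plus:
  "(\<Sum>a\<in>UNIV. f a) = (\<Sum>i\<in>UNIV. f (Inl i)) + (\<Sum>i\<in>UNIV. f (Inr i))"
  for f :: "'n::finite + 'm::finite \<Rightarrow> 'b::comm_monoid_add"
  by (simp flip: UNIV_Plus_UNIV add: sum.Plus)

lemma sum_lists_Suc:
  fixes f :: "'a::finite list \<Rightarrow> 'b::comm_monoid_add"
  shows "(\<Sum>is | length is = Suc p. f is) = (\<Sum>i\<in>UNIV. \<Sum>is | length is = p. f (i # is))"
proof -
  have "{is :: 'a list. length is = Suc p} = (\<lambda>(i, is). i # is) ` (UNIV \<times> {is. length is = p})"
    by (auto simp: length_Suc_conv image_iff)
  moreover have "inj_on (\<lambda>(i, is). i # is) (UNIV \<times> {is :: 'a list. length is = p})"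
    by (auto simp: inj_on_def)
  ultimately show ?thesis
    by (simp add: sum.reindex sum.cartesian_product case_prod_unfold)
qed

lemma scale_simps [simp]:
  "scale 0 \<alpha> = 0" "scale 1 \<alpha> = \<alpha>" "scale k 0 = 0" "scale k (scale m \<alpha>) = scale (k * m) \<alpha>"
  by (auto simp: pointwise scale_def fun_eq_iff)

lemma scale_add: "scale k (\<alpha> + \<beta>) = scale k \<alpha> + scale k \<beta>"
  and scale_add_left: "scale (k + m) \<alpha> = scale k \<alpha> + scale m \<alpha>"
  and scale_diff: "scale k (\<alpha> - \<beta>) = scale k \<alpha> - scale k \<beta>"
  by (auto simp: pointwise scale_def fun_eq_iff algebra_simps)

lemma scale_sum: "scale k (\<Sum>i\<in>I. f i) = (\<Sum>i\<in>I. scale k (f i))"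
  by (auto simp: scale_def fun_eq_iff sum_fun_apply sum_distrib_left)

lemma ip_apply: "ip b \<alpha> l = \<alpha> (b # l)"
  by (simp add: interior_product_def)

lemma ip_simps:
  "ip b 0 = 0" "ip b (\<alpha> + \<beta>) = ip b \<alpha> + ip b \<beta>" "ip b (\<alpha> - \<beta>) = ip b \<alpha> - ip b \<beta>"
  "ip b (- \<alpha>) = - ip b \<alpha>" "ip b (scale k \<alpha>) = scale k (ip b \<alpha>)"
  "ip b (\<Sum>i\<in>I. f i) = (\<Sum>i\<in>I. ip b (f i))"
  by (auto simp: pointwise fun_eq_iff scale_def sum_fun_apply ip_apply)

lemma parity_simps:
  "parity 0 = 0" "parity (parity \<alpha>) = \<alpha>" "ip b (parity \<alpha>) = - parity (ip b \<alpha>)"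
  "parity (\<alpha> + \<beta>) = parity \<alpha> + parity \<beta>" "parity (- \<alpha>) = - parity \<alpha>"
proof -
  show "parity (parity \<alpha>) = \<alpha>"
    by (simp add: fun_eq_iff parity_def flip: mult.assoc power_mult_distrib)
qed (auto simp: pointwise fun_eq_iff parity_def ip_apply distrib_left)

lemma wedge_add_left: "wedge (\<alpha> + \<alpha>') \<beta> = wedge \<alpha> \<beta> + wedge \<alpha>' \<beta>"
  and wedge_add_right: "wedge \<beta> (\<alpha> + \<alpha>') = wedge \<beta> \<alpha> + wedge \<beta> \<alpha>'"
  and wedge_scale_left: "wedge (scale k \<alpha>) \<beta> = scale k (wedge \<alpha> \<beta>)"
  and wedge_scale_right: "wedge \<alpha> (scale k \<beta>) = scale k (wedge \<alpha> \<beta>)"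
  and wedge_zero [simp]: "wedge 0 \<beta> = 0" "wedge \<alpha> 0 = 0"
  by (auto simp: pointwise wedge_def fun_eq_iff scale_def sum.distrib sum_distrib_left algebra_simps)

lemma wedge_uminus_left: "wedge (- \<alpha>) \<beta> = - wedge \<alpha> \<beta>"
  and wedge_uminus_right: "wedge \<alpha> (- \<beta>) = - wedge \<alpha> \<beta>"
  by (auto simp: pointwise wedge_def fun_eq_iff sum_negf)

lemma wedge_diff_left: "wedge (\<alpha> - \<alpha>') \<beta> = wedge \<alpha> \<beta> - wedge \<alpha>' \<beta>"
  and wedge_diff_right: "wedge \<beta> (\<alpha> - \<alpha>') = wedge \<beta> \<alpha> - wedge \<beta> \<alpha>'"
  using wedge_add_left [of \<alpha> "- \<alpha>'" \<beta>] wedge_add_right [of \<beta> \<alpha> "- \<alpha>'"]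
  by (simp_all add: wedge_uminus_left wedge_uminus_right)

lemma wedge_sum_left: "wedge (\<Sum>i\<in>I. f i) \<beta> = (\<Sum>i\<in>I. wedge (f i) \<beta>)"
  by (induction I rule: infinite_finite_induct)
    (simp_all add: wedge_add_left)

lemma wedge_sum_right: "wedge \<beta> (\<Sum>i\<in>I. f i) = (\<Sum>i\<in>I. wedge \<beta> (f i))"
  by (induction I rule: infinite_finite_induct)
    (simp_all add: wedge_add_right)

section \<open>Laws of the exterior algebra\<close>

lemma ip_wedge: "ip b (wedge \<alpha> \<beta>) = wedge (ip b \<alpha>) \<beta> + wedge (parity \<alpha>) (ip b \<beta>)"
  by (simp add: pointwise fun_eq_iff wedge_Cons ip_apply)

lemma parity_wedge: "parity (wedge \<alpha> \<beta>) = wedge (parity \<alpha>) (parity \<beta>)"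
proof
  show "parity (wedge \<alpha> \<beta>) l = wedge (parity \<alpha>) (parity \<beta>) l" for l
  proof (induction l arbitrary: \<alpha> \<beta>)
    case (Cons b l)
    have "parity (wedge \<alpha> \<beta>) (b # l) = - parity (wedge (ip b \<alpha>) \<beta>) l - parity (wedge (parity \<alpha>) (ip b \<beta>)) l"
      by (simp add: parity_def [of "wedge _ _"] wedge_Cons algebra_simps)
    then show ?case
      by (simp add: Cons.IH wedge_Cons parity_simps wedge_uminus_left wedge_uminus_right)
  qed (simp add: parity_def)
qed

lemma unit_form_simps: "ip b unit_form = 0" "parity unit_form = unit_form" "unit_form [] = 1"
  by (auto simp: pointwise unit_form_def parity_def fun_eq_iff ip_apply)

lemma wedge_unit_left [simp]: "wedge unit_form \<alpha> = \<alpha>"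
proof
  show "wedge unit_form \<alpha> l = \<alpha> l" for l
    by (induction l arbitrary: \<alpha>) (auto simp: pointwise wedge_Cons unit_form_simps ip_apply)
qed

lemma wedge_unit_right [simp]: "wedge \<alpha> unit_form = \<alpha>"
proof
  show "wedge \<alpha> unit_form l = \<alpha> l" for l
    by (induction l arbitrary: \<alpha>) (auto simp: pointwise wedge_Cons unit_form_simps ip_apply)
qed

text \<open>Both sides satisfy the same recursion: peeling off an argument gives one term per
  factor, and the signs agree because \<open>parity\<close> is multiplicative.\<close>

lemma wedge_assoc: "wedge (wedge \<alpha> \<beta>) \<gamma> = wedge \<alpha> (wedge \<beta> \<gamma>)"
proof
  show "wedge (wedge \<alpha> \<beta>) \<gamma> l = wedge \<alpha> (wedge \<beta> \<gamma>) l" for l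
    by (induction l arbitrary: \<alpha> \<beta> \<gamma>)
      (auto simp: pointwise wedge_Cons ip_wedge wedge_add_left wedge_add_right parity_wedge)
qed

lemma one_form_ip: "one_form \<kappa> \<Longrightarrow> ip b \<kappa> = scale (\<kappa> [b]) unit_form"
  by (auto simp: pointwise one_form_def scale_def unit_form_def fun_eq_iff ip_apply)

lemma one_form_parity:
  assumes "one_form \<kappa>"
  shows "parity \<kappa> = - \<kappa>"
proof
  show "parity \<kappa> l = (- \<kappa>) l" for l
    using assms by (cases "length l = 1") (auto simp: one_form_def parity_def)
qed

lemma ip_wedge_one_form: "one_form \<kappa> \<Longrightarrow> ip b (wedge \<kappa> \<beta>) = scale (\<kappa> [b]) \<beta> - wedge \<kappa> (ip b \<beta>)"
  by (simp add: ip_wedge one_form_ip one_form_parity wedge_scale_left wedge_uminus_left)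

lemma one_form_Nil: "one_form \<kappa> \<Longrightarrow> \<kappa> [] = 0"
  by (simp add: pointwise one_form_def)

text \<open>Graded commutativity with a factor of degree one: both sides vanish on the empty list
  and have, by induction, the same interior products.\<close>

lemma one_form_commute:
  assumes "one_form \<kappa>"
  shows "wedge \<kappa> \<alpha> = wedge (parity \<alpha>) \<kappa>"
proof
  show "wedge \<kappa> \<alpha> l = wedge (parity \<alpha>) \<kappa> l" for l
    using assms
    by (induction l arbitrary: \<alpha>)
      (auto simp: pointwise wedge_Cons one_form_Nil one_form_ip one_form_parity parity_simps
        wedge_scale_left wedge_scale_right wedge_uminus_left)
qed

lemma one_form_eqI:
  assumes "one_form \<alpha>" "one_form \<beta>" "\<And>b. \<alpha> [b] = \<beta> [b]"
  shows "\<alpha> = \<beta>"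
proof
  show "\<alpha> l = \<beta> l" for l
    using assms by (cases "length l = 1") (auto simp: one_form_def length_Suc_conv)
qed

lemma one_form_intros:
  "one_form (coframe a)" "one_form 0"
  "one_form \<alpha> \<Longrightarrow> one_form \<beta> \<Longrightarrow> one_form (\<alpha> + \<beta>)"
  "one_form \<alpha> \<Longrightarrow> one_form \<beta> \<Longrightarrow> one_form (\<alpha> - \<beta>)"
  "one_form \<alpha> \<Longrightarrow> one_form (scale k \<alpha>)"
  by (auto simp: pointwise one_form_def scale_def coframe_def)

lemma one_form_sum: "(\<And>i. i \<in> I \<Longrightarrow> one_form (f i)) \<Longrightarrow> one_form (\<Sum>i\<in>I. f i)"
  by (auto simp: pointwise one_form_def sum_fun_apply)

lemma coframe_apply: "coframe a [b] = (if b = a then 1 else 0)"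
  by (simp add: coframe_def)

section \<open>Contraction as a derivation\<close>

lemma pcontract_simps:
  "pcontract K 0 = 0" "pcontract K (\<alpha> + \<beta>) = pcontract K \<alpha> + pcontract K \<beta>"
  "pcontract K (\<alpha> - \<beta>) = pcontract K \<alpha> - pcontract K \<beta>"
  "pcontract K (scale k \<alpha>) = scale k (pcontract K \<alpha>)"
  by (auto simp: pcontract_def ip_simps wedge_add_right wedge_diff_right wedge_scale_right sum.distrib
      sum_subtractf scale_sum)

lemma pcontract_sum: "pcontract K (\<Sum>i\<in>I. f i) = (\<Sum>i\<in>I. pcontract K (f i))"
  by (induction I rule: infinite_finite_induct)
    (simp_all add: pcontract_simps)

lemma pcontract_unit: "pcontract K unit_form = 0"
  by (simp add: pcontract_def unit_form_simps)

text \<open>Moving the 1-form \<open>K b\<close> past \<open>\<alpha>\<close> costs the same sign as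
  moving the interior product past it. The two signs cancel, which makes contraction a derivation of
  degree 0.\<close>

lemma pcontract_wedge:
  assumes "\<And>b. one_form (K b)"
  shows "pcontract K (wedge \<alpha> \<beta>) = wedge (pcontract K \<alpha>) \<beta> + wedge \<alpha> (pcontract K \<beta>)"
proof -
  have "wedge (K b) (wedge (parity \<alpha>) (ip b \<beta>)) = wedge \<alpha> (wedge (K b) (ip b \<beta>))" for b
    using one_form_commute [OF assms, of b "parity \<alpha>"] by (simp add: parity_simps flip: wedge_assoc)
  then show ?thesis
    by (simp add: pcontract_def ip_wedge wedge_add_right sum.distrib wedge_assoc wedge_sum_left wedge_sum_right)
qed

lemma pcontract_one_form: "one_form \<kappa> \<Longrightarrow> pcontract K \<kappa> = (\<Sum>b\<in>UNIV. scale (\<kappa> [b]) (K b))"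
  by (simp add: pcontract_def one_form_ip wedge_scale_right)

lemma pcontract_coframe: "pcontract K (coframe a) = K a"
proof -
  have "scale (coframe a [b]) (K b) = (if b = a then K b else 0)" for b
    by (simp add: coframe_apply)
  then show ?thesis
    by (simp add: pcontract_one_form one_form_intros)
qed

section \<open>Alternating forms and the Euler identity\<close>

lemma alternating_ip: "alternating \<alpha> \<Longrightarrow> alternating (ip b \<alpha>)"
  unfolding alternating_def
proof (intro allI impI)
  fix l :: "('a + 'a) list" and i j
  assume *: "\<forall>l i j. i < j \<and> j < length l \<longrightarrow> \<alpha> (l[i := l ! j, j := l ! i]) = - \<alpha> l" and "i < j \<and> j < length l"
  then show "ip b \<alpha> (l[i := l ! j, j := l ! i]) = - ip b \<alpha> l"
    using * [rule_format, of "Suc i" "Suc j" "b # l"] by (simp add: ip_apply)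
qed

lemma alternating_ip_ip:
  assumes "alternating \<alpha>"
  shows "ip a (ip b \<alpha>) = - ip b (ip a \<alpha>)"
proof
  fix l
  show "ip a (ip b \<alpha>) l = (- ip b (ip a \<alpha>)) l"
    using assms [unfolded alternating_def, rule_format, of 0 1 "a # b # l"] by (simp add: ip_apply)
qed

lemma alternating_distinct:
  assumes "alternating \<alpha>" "\<not> distinct l"
  shows "\<alpha> l = 0"
proof -
  obtain i j where ij: "i < j" "j < length l" "l ! i = l ! j"
    using assms(2) by (metis distinct_conv_nth linorder_neqE)
  have "\<alpha> (l[i := l ! j, j := l ! i]) = - \<alpha> l"
    using assms(1) ij unfolding alternating_def by blast
  then show ?thesis
    using ij list_update_id [of l i] list_update_id [of l j] by simp
qed

text \<open>The number operator of the slots in \<open>B\<close>. Applying \<open>ip b\<close> to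
  the sum splits off \<open>ip b \<alpha>\<close> once if \<open>b\<close> lies in \<open>B\<close>
  and leaves the same sum formed with \<open>ip b \<alpha>\<close>: the sign from passing
  \<open>coframe a\<close> is cancelled by the anticommutation of interior products.\<close>

lemma alternating_euler:
  fixes B :: "('n::finite + 'n) set"
  assumes "alternating \<alpha>"
  shows "(\<Sum>a\<in>B. wedge (coframe a) (ip a \<alpha>)) l = of_nat (length (filter (\<lambda>a. a \<in> B) l)) * \<alpha> l"
  using assms
proof (induction l arbitrary: \<alpha>)
  case Nil
  then show ?case by (simp add: pointwise sum_fun_apply coframe_def)
next
  case (Cons b l)
  have "ip b (\<Sum>a\<in>B. wedge (coframe a) (ip a \<alpha>))
      = (\<Sum>a\<in>B. if a = b then ip b \<alpha> else 0) + (\<Sum>a\<in>B. wedge (coframe a) (ip a (ip b \<alpha>)))"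
    unfolding ip_simps sum.distrib [symmetric]
    by (intro sum.cong refl, subst alternating_ip_ip [OF Cons.prems])
       (auto simp: ip_wedge_one_form one_form_intros coframe_apply wedge_uminus_right)
  then have "(\<Sum>a\<in>B. wedge (coframe a) (ip a \<alpha>)) (b # l)
      = (if b \<in> B then \<alpha> (b # l) else 0) + (\<Sum>a\<in>B. wedge (coframe a) (ip a (ip b \<alpha>))) l"
    by (auto simp: pointwise fun_eq_iff ip_apply split: if_splits)
  then show ?case
    by (simp add: Cons.IH [OF alternating_ip [OF Cons.prems]] ip_apply [of b \<alpha> l] distrib_right)
qed

section \<open>The exponential of a contraction on products of 1-forms\<close>

lemma scale_apply: "scale k \<alpha> l = k * \<alpha> l"
  by (simp add: scale_def)

text \<open>Leibniz' rule for powers of a derivation D. As D kills D \<kappa>, only the terms of the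
  binomial expansion with at most one D on \<kappa> survive. At \<open>k = 0\<close> the truncated
  exponent \<open>k - 1\<close> is harmless, because the coefficient \<open>of_nat k\<close> is
  0.\<close>

lemma funpow_pcontract_wedge:
  assumes K: "\<And>b. one_form (K b)" and \<kappa>: "pcontract K (pcontract K \<kappa>) = 0"
  shows "(pcontract K ^^ k) (wedge \<kappa> \<beta>)
    = wedge \<kappa> ((pcontract K ^^ k) \<beta>) + scale (of_nat k) (wedge (pcontract K \<kappa>) ((pcontract K ^^ (k - 1)) \<beta>))"
proof (induction k)
  case (Suc k)
  have "scale (of_nat k) (wedge (pcontract K \<kappa>) (pcontract K ((pcontract K ^^ (k - 1)) \<beta>)))
      = scale (of_nat k) (wedge (pcontract K \<kappa>) ((pcontract K ^^ k) \<beta>))"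
    by (cases k) auto
  then show ?case
    by (simp add: Suc.IH pcontract_simps pcontract_wedge [OF K] \<kappa> scale_add_left add_ac)
qed simp

text \<open>The exponential of a derivation D is multiplicative, and on a 1-form \<kappa> with D (D
  \<kappa>) = 0 its series stops at \<kappa> + D \<kappa>. Stating this with \<open>sums\<close>
  lets the induction on the factors carry convergence along.\<close>

lemma pexp_wedge_list_sums:
  assumes K: "\<And>b. one_form (K b)" and c: "\<And>\<kappa>. \<kappa> \<in> set cs \<Longrightarrow> pcontract K (pcontract K \<kappa>) = 0"
  shows "(\<lambda>k. 1 / fact k * (pcontract K ^^ k) (wedge_list cs) l) sums
    wedge_list (map (\<lambda>\<kappa>. \<kappa> + pcontract K \<kappa>) cs) l"
  using c
proof (induction cs arbitrary: l)
  case Nil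
  have "(pcontract K ^^ k) unit_form = (if k = 0 then unit_form else 0)" for k
    by (induction k) (auto simp: pcontract_unit pcontract_simps)
  then have "(\<lambda>k. 1 / fact k * (pcontract K ^^ k) unit_form l) = (\<lambda>k. if k = 0 then unit_form l else 0)"
    by (auto simp: pointwise)
  then show ?case
    using sums_single [of 0 "\<lambda>_. unit_form l"] by (simp add: wedge_list_def)
next
  case (Cons \<kappa> cs)
  let ?D = "pcontract K"
  let ?W = "wedge_list cs" and ?E = "wedge_list (map (\<lambda>\<kappa>. \<kappa> + ?D \<kappa>) cs)"
  \<comment> \<open>At a fixed list, \<open>wedge\<close> is a finite linear combination of
    coefficients of the second factor, so the limit passes through it.\<close>
  have sums: "(\<lambda>k. wedge \<alpha> (scale (1 / fact k) ((?D ^^ k) ?W)) l) sums wedge \<alpha> ?E l" for \<alpha> l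
    unfolding wedge_def scale_def
    by (intro sums_sum sums_mult) (use Cons in auto)
  \<comment> \<open>The terms with one D on \<kappa>: since k / k! = 1 / (k - 1)!, they form the
    series of the remaining factors shifted by one, with a vanishing term at 0.\<close>
  have "(\<lambda>k. scale (of_nat k / fact k) (wedge (?D \<kappa>) ((?D ^^ (k - 1)) ?W)) l) sums wedge (?D \<kappa>) ?E l"
  proof -
    have "scale (of_nat (Suc k) / fact (Suc k)) (wedge (?D \<kappa>) ((?D ^^ k) ?W)) l
        = wedge (?D \<kappa>) (scale (1 / fact k) ((?D ^^ k) ?W)) l" for k
      by (simp add: wedge_scale_right scale_apply fact_Suc divide_simps del: of_nat_Suc)
    then have "(\<lambda>k. scale (of_nat (Suc k) / fact (Suc k)) (wedge (?D \<kappa>) ((?D ^^ (Suc k - 1)) ?W)) l) sums wedge (?D \<kappa>) ?E l"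
      using sums [of "?D \<kappa>" l] by simp
    from sums_Suc [OF this] show ?thesis
      by (simp add: pointwise)
  qed
  from sums_add [OF sums [of \<kappa> l] this]
  have "(\<lambda>k. scale (1 / fact k) (wedge \<kappa> ((?D ^^ k) ?W)) l
      + scale (of_nat k / fact k) (wedge (?D \<kappa>) ((?D ^^ (k - 1)) ?W)) l) sums wedge (\<kappa> + ?D \<kappa>) ?E l"
    by (simp add: wedge_scale_right wedge_add_left plus_fun_apply)
  moreover have "scale (1 / fact k) (wedge \<kappa> ((?D ^^ k) ?W)) l
      + scale (of_nat k / fact k) (wedge (?D \<kappa>) ((?D ^^ (k - 1)) ?W)) l
      = 1 / fact k * (?D ^^ k) (wedge_list (\<kappa> # cs)) l" for k
    using funpow_pcontract_wedge [OF K, where \<kappa> = \<kappa> and k = k and \<beta> = ?W] Cons.prems [of \<kappa>]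
    by (simp add: wedge_list_def plus_fun_apply scale_apply distrib_left)
  ultimately show ?case
    by (simp add: wedge_list_def)
qed

lemma pexp_wedge_list:
  assumes "\<And>b. one_form (K b)" "\<And>\<kappa>. \<kappa> \<in> set cs \<Longrightarrow> pcontract K (pcontract K \<kappa>) = 0"
  shows "pexp K (wedge_list cs) = wedge_list (map (\<lambda>\<kappa>. \<kappa> + pcontract K \<kappa>) cs)"
  using sums_unique [OF pexp_wedge_list_sums [OF assms]] by (simp add: pexp_def fun_eq_iff)

section \<open>Algebra endomorphisms induced by a matrix on the coframe\<close>

text \<open>
  The value of \<open>pull P \<alpha>\<close> at \<open>l\<close> is the sum of \<open>(\<Prod>j. P (m ! j) (l ! j)) * \<alpha> m\<close> over all lists \<open>m\<close> of the
  same length.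
\<close>

fun pull :: "('n::finite + 'n \<Rightarrow> 'n + 'n \<Rightarrow> complex) \<Rightarrow> 'n pform \<Rightarrow> 'n pform" where
  "pull P \<alpha> [] = \<alpha> []"
| "pull P \<alpha> (b # l) = (\<Sum>a\<in>UNIV. P a b * pull P (ip a \<alpha>) l)"

lemma pull_add: "pull P (\<alpha> + \<beta>) = pull P \<alpha> + pull P \<beta>"
  and pull_scale: "pull P (scale k \<alpha>) = scale k (pull P \<alpha>)"
  and pull_uminus: "pull P (- \<alpha>) = - pull P \<alpha>"
  and pull_zero: "pull P 0 = 0"
  and pull_parity: "pull P (parity \<alpha>) = parity (pull P \<alpha>)"
proof -
  show add: "pull P (\<alpha> + \<beta>) = pull P \<alpha> + pull P \<beta>" for \<alpha> \<beta>
  proof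
    show "pull P (\<alpha> + \<beta>) l = (pull P \<alpha> + pull P \<beta>) l" for l
      by (induction l arbitrary: \<alpha> \<beta>) (auto simp: pointwise ip_simps distrib_left sum.distrib)
  qed
  show scale: "pull P (scale k \<alpha>) = scale k (pull P \<alpha>)" for k \<alpha>
  proof
    show "pull P (scale k \<alpha>) l = scale k (pull P \<alpha>) l" for l
      by (induction l arbitrary: \<alpha>) (auto simp: scale_def [of _ "pull P _"] ip_simps sum_distrib_left ac_simps, simp add: scale_def)
  qed
  have neg: "- \<alpha> = scale (- 1) \<alpha>" for \<alpha> :: "'a pform"
    by (simp add: scale_def fun_eq_iff)
  show neg': "pull P (- \<alpha>) = - pull P \<alpha>" for \<alpha>
    unfolding neg by (rule scale)
  show "pull P 0 = 0"
    using scale [of 0 0] by simp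
  show "pull P (parity \<alpha>) = parity (pull P \<alpha>)"
  proof
    show "pull P (parity \<alpha>) l = parity (pull P \<alpha>) l" for l
    proof (induction l arbitrary: \<alpha>)
      case (Cons b l)
      have "pull P (parity \<alpha>) (b # l) = - (\<Sum>a\<in>UNIV. P a b * parity (pull P (ip a \<alpha>)) l)"
        by (simp add: parity_simps neg' Cons.IH sum_negf)
      then show ?case
        by (simp add: parity_def sum_distrib_left sum_negf ac_simps)
    qed (simp add: parity_def)
  qed
qed

lemma ip_pull: "ip b (pull P \<alpha>) = (\<Sum>a\<in>UNIV. scale (P a b) (pull P (ip a \<alpha>)))"
  by (simp add: fun_eq_iff ip_apply [of b "pull P \<alpha>"] sum_fun_apply scale_def)

lemma pull_sum: "pull P (\<Sum>i\<in>I. f i) = (\<Sum>i\<in>I. pull P (f i))"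
  by (induction I rule: infinite_finite_induct) (simp_all add: pull_add pull_zero)

text \<open>\<open>pull P\<close> is the algebra endomorphism that sends \<open>coframe a\<close> to
  the 1-form with coefficients \<open>P a b\<close>. Multiplicativity follows from the recursion of
  \<open>wedge\<close>, because \<open>pull P\<close> commutes with \<open>parity\<close> and
  \<open>ip_pull\<close> has the same coefficients for both factors.\<close>

lemma pull_wedge: "pull P (wedge \<alpha> \<beta>) = wedge (pull P \<alpha>) (pull P \<beta>)"
proof
  show "pull P (wedge \<alpha> \<beta>) l = wedge (pull P \<alpha>) (pull P \<beta>) l" for l
  proof (induction l arbitrary: \<alpha> \<beta>)
    case (Cons b l)
    have "ip b (wedge (pull P \<alpha>) (pull P \<beta>))
      = (\<Sum>a\<in>UNIV. scale (P a b) (wedge (pull P (ip a \<alpha>)) (pull P \<beta>) + wedge (pull P (parity \<alpha>)) (pull P (ip a \<beta>))))"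
      by (simp add: ip_wedge ip_pull wedge_sum_left wedge_sum_right wedge_scale_left wedge_scale_right
          scale_add sum.distrib pull_parity)
    moreover have "pull P (wedge \<alpha> \<beta>) (b # l)
      = (\<Sum>a\<in>UNIV. P a b * (wedge (pull P (ip a \<alpha>)) (pull P \<beta>) l + wedge (pull P (parity \<alpha>)) (pull P (ip a \<beta>)) l))"
      by (simp add: ip_wedge pull_add Cons.IH plus_fun_apply)
    ultimately show ?case
      by (simp add: fun_eq_iff ip_apply [of b "wedge _ _"] sum_fun_apply scale_apply plus_fun_apply)
  qed simp
qed

lemma pull_unit: "pull P unit_form = unit_form"
proof
  show "pull P unit_form l = unit_form l" for l
    by (cases l) (auto simp: unit_form_simps pull_zero pointwise, simp add: unit_form_def)
qed

lemma one_form_pull: "one_form \<kappa> \<Longrightarrow> one_form (pull P \<kappa>)"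
  unfolding one_form_def
proof (intro allI impI)
  fix l :: "('a + 'a) list" assume *: "\<forall>l. length l \<noteq> 1 \<longrightarrow> \<kappa> l = 0" "length l \<noteq> 1"
  then have "one_form \<kappa>" by (simp add: one_form_def)
  then show "pull P \<kappa> l = 0"
    using * by (cases l) (auto simp: one_form_ip pull_scale pull_unit scale_apply, simp add: unit_form_def)
qed

lemma pull_one_form: "one_form \<kappa> \<Longrightarrow> pull P \<kappa> [b] = (\<Sum>a\<in>UNIV. P a b * \<kappa> [a])"
  by (simp add: ip_apply)

lemma pull_coframe: "pull P (coframe a) [b] = P a b"
proof -
  have "P c b * coframe a [c] = (if c = a then P c b else 0)" for c
    by (simp add: coframe_apply)
  then show ?thesis
    using pull_one_form [OF one_form_intros(1), of P a b] by simp
qed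

lemma wedge_list_append: "wedge_list (as @ bs) = wedge (wedge_list as) (wedge_list bs)"
  by (induction as) (auto simp: wedge_list_def wedge_assoc)

lemma pull_wedge_list: "pull P (wedge_list cs) = wedge_list (map (pull P) cs)"
  by (induction cs) (auto simp: wedge_list_def pull_wedge pull_unit)

section \<open>Forms of type (p,q) and their expansion in monomials\<close>

lemma bidegree_ip_Inl:
  assumes "bidegree (Suc p) q \<alpha>"
  shows "bidegree p q (ip (Inl i) \<alpha>)"
  unfolding bidegree_def
proof (intro allI impI)
  fix l assume "ip (Inl i) \<alpha> l \<noteq> 0"
  then show "length (filter isl l) = p \<and> length (filter (\<lambda>a. \<not> isl a) l) = q"
    using assms [unfolded bidegree_def, rule_format, of "Inl i # l"] by (simp add: ip_apply)
qed

lemma bidegree_ip_Inr: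
  assumes "bidegree p (Suc q) \<alpha>"
  shows "bidegree p q (ip (Inr i) \<alpha>)"
  unfolding bidegree_def
proof (intro allI impI)
  fix l assume "ip (Inr i) \<alpha> l \<noteq> 0"
  then show "length (filter isl l) = p \<and> length (filter (\<lambda>a. \<not> isl a) l) = q"
    using assms [unfolded bidegree_def, rule_format, of "Inr i # l"] by (simp add: ip_apply)
qed

lemma euler_Inl:
  fixes \<alpha> :: "'n::finite pform"
  assumes "alternating \<alpha>" "bidegree p q \<alpha>"
  shows "(\<Sum>i\<in>UNIV. wedge (coframe (Inl i)) (ip (Inl i) \<alpha>)) = scale (of_nat p) \<alpha>"
proof
  fix l :: "('n + 'n) list"
  have *: "(\<Sum>a\<in>range Inl. wedge (coframe a) (ip a \<alpha>)) = (\<Sum>i\<in>UNIV. wedge (coframe (Inl i)) (ip (Inl i) \<alpha>))"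
    by (simp add: sum.reindex)
  have "filter (\<lambda>a. a \<in> range Inl) l = filter isl l"
    by (rule filter_cong) (auto simp: isl_def)
  then show "(\<Sum>i\<in>UNIV. wedge (coframe (Inl i)) (ip (Inl i) \<alpha>)) l = scale (of_nat p) \<alpha> l"
    using alternating_euler [OF assms(1), of "range Inl" l] assms(2)
    by (auto simp: * scale_def bidegree_def)
qed

lemma euler_Inr:
  fixes \<alpha> :: "'n::finite pform"
  assumes "alternating \<alpha>" "bidegree p q \<alpha>"
  shows "(\<Sum>i\<in>UNIV. wedge (coframe (Inr i)) (ip (Inr i) \<alpha>)) = scale (of_nat q) \<alpha>"
proof
  fix l :: "('n + 'n) list"
  have *: "(\<Sum>a\<in>range Inr. wedge (coframe a) (ip a \<alpha>)) = (\<Sum>i\<in>UNIV. wedge (coframe (Inr i)) (ip (Inr i) \<alpha>))"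
    by (simp add: sum.reindex)
  have "filter (\<lambda>a. a \<in> range Inr) l = filter (\<lambda>a. \<not> isl a) l"
    by (rule filter_cong) (auto simp: isl_def image_iff, metis sum.exhaust)
  then show "(\<Sum>i\<in>UNIV. wedge (coframe (Inr i)) (ip (Inr i) \<alpha>)) l = scale (of_nat q) \<alpha> l"
    using alternating_euler [OF assms(1), of "range Inr" l] assms(2)
    by (auto simp: * scale_def bidegree_def)
qed

lemma bidegree_0_0:
  assumes b: "bidegree 0 0 \<alpha>"
  shows "\<alpha> = scale (\<alpha> []) unit_form"
proof
  fix l :: "('a + 'a) list"
  have "length l = length (filter isl l) + length (filter (\<lambda>a. \<not> isl a) l)"
    by (simp add: sum_length_filter_compl)
  then show "\<alpha> l = scale (\<alpha> []) unit_form l"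
    using b by (cases "\<alpha> l = 0") (auto simp: bidegree_def scale_def unit_form_def)
qed

text \<open>Euler's identity writes p times \<alpha> as a sum of dz^i wedged with interior products
  of type (p - 1, q). Dividing by p at each stage builds up the factorial; once no holomorphic slot
  is left, an inner induction does the same for q.\<close>

lemma expand_bidegree:
  fixes \<alpha> :: "'n::finite pform"
  assumes "alternating \<alpha>" "bidegree p q \<alpha>"
  shows "\<alpha> = (\<Sum>is | length is = p. \<Sum>js | length js = q.
    scale (1 / (fact p * fact q) * \<alpha> (map Inl is @ map Inr js)) (wedge_list (map coframe (map Inl is @ map Inr js))))"
  using assms
proof (induction p arbitrary: \<alpha>)
  case 0
  then show ?case
  proof (induction q arbitrary: \<alpha>)
    case 0
    then show ?case
      by (simp add: wedge_list_def flip: bidegree_0_0)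
  next
    case (Suc q)
    let ?W = "\<lambda>js. wedge_list (map coframe (map Inl [] @ map Inr js))"
    have A: "ip (Inr j) \<alpha> (map Inr js) = \<alpha> (map Inr (j # js))" for j js
      by (simp add: ip_apply)
    have IH: "ip (Inr j) \<alpha> = (\<Sum>js | length js = q. scale (1 / fact q * \<alpha> (map Inr (j # js))) (?W js))" for j
      using Suc.IH [OF alternating_ip [OF Suc.prems(1)] bidegree_ip_Inr [OF Suc.prems(2)], of j]
      by (simp add: A)
    have W: "wedge (coframe (Inr j)) (?W js) = ?W (j # js)" for j js
      by (simp add: wedge_list_def)
    have C: "1 / of_nat (Suc q) * (1 / fact q * x) = 1 / (fact 0 * fact (Suc q)) * x" for x :: complex
      by (simp add: fact_Suc del: of_nat_Suc)
    have "\<alpha> = scale (1 / of_nat (Suc q)) (scale (of_nat (Suc q)) \<alpha>)"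
      by (simp del: of_nat_Suc)
    also have "\<dots> = scale (1 / of_nat (Suc q)) (\<Sum>j\<in>UNIV. wedge (coframe (Inr j)) (ip (Inr j) \<alpha>))"
      using euler_Inr [OF Suc.prems] by simp
    also have "\<dots> = (\<Sum>j\<in>UNIV. \<Sum>js | length js = q.
        scale (1 / (fact 0 * fact (Suc q)) * \<alpha> (map Inr (j # js))) (?W (j # js)))"
      by (simp only: IH wedge_sum_right wedge_scale_right W scale_sum scale_simps C)
    also have "\<dots> = (\<Sum>js | length js = Suc q. scale (1 / (fact 0 * fact (Suc q)) * \<alpha> (map Inr js)) (?W js))"
      by (rule sum_lists_Suc [symmetric])
    finally show ?case
      by simp
  qed
next
  case (Suc p)
  let ?W = "\<lambda>is js. wedge_list (map coframe (map Inl is @ map Inr js))"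
  have A: "ip (Inl i) \<alpha> (map Inl is @ map Inr js) = \<alpha> (map Inl (i # is) @ map Inr js)" for i "is" js
    by (simp add: ip_apply)
  have IH: "ip (Inl i) \<alpha> = (\<Sum>is | length is = p. \<Sum>js | length js = q.
      scale (1 / (fact p * fact q) * \<alpha> (map Inl (i # is) @ map Inr js)) (?W is js))" for i
    using Suc.IH [OF alternating_ip [OF Suc.prems(1)] bidegree_ip_Inl [OF Suc.prems(2)], of i]
    by (simp only: A)
  have W: "wedge (coframe (Inl i)) (?W is js) = ?W (i # is) js" for i "is" js
    by (simp add: wedge_list_def)
  have C: "1 / of_nat (Suc p) * (1 / (fact p * fact q) * x) = 1 / (fact (Suc p) * fact q) * x" for x :: complex
    by (simp add: fact_Suc del: of_nat_Suc)
  have "\<alpha> = scale (1 / of_nat (Suc p)) (scale (of_nat (Suc p)) \<alpha>)"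
    by (simp del: of_nat_Suc)
  also have "\<dots> = scale (1 / of_nat (Suc p)) (\<Sum>i\<in>UNIV. wedge (coframe (Inl i)) (ip (Inl i) \<alpha>))"
    using euler_Inl [OF Suc.prems] by simp
  also have "\<dots> = (\<Sum>i\<in>UNIV. \<Sum>is | length is = p. \<Sum>js | length js = q.
      scale (1 / (fact (Suc p) * fact q) * \<alpha> (map Inl (i # is) @ map Inr js)) (?W (i # is) js))"
    by (simp only: IH wedge_sum_right wedge_scale_right W scale_sum scale_simps C)
  also have "\<dots> = (\<Sum>is | length is = Suc p. \<Sum>js | length js = q.
      scale (1 / (fact (Suc p) * fact q) * \<alpha> (map Inl is @ map Inr js)) (?W is js))"
    by (rule sum_lists_Suc [symmetric])
  finally show ?case .
qed

section \<open>The extension map as an algebra endomorphism\<close>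

definition beltrami :: "'n pvform \<Rightarrow> bool" where
  "beltrami K \<longleftrightarrow> (\<forall>b. bidegree 0 1 (K b)) \<and> (\<forall>i. K (Inr i) = 0)"

text \<open>The matrix whose row \<open>a\<close> is the image of \<open>coframe a\<close> under the
  extension map. For a Beltrami differential at most one of the last two summands is nonzero, since
  \<open>K\<close> has only \<open>Inl\<close> components and \<open>pconj K\<close> only
  \<open>Inr\<close> components.\<close>

definition frame :: "'n pvform \<Rightarrow> 'n + 'n \<Rightarrow> 'n + 'n \<Rightarrow> complex" where
  "frame K a b = coframe a [b] + K a [b] + pconj K a [b]"

lemma beltramiD:
  assumes "beltrami K"
  shows "K (Inr i) = 0" "one_form (K b)" "K b [Inl k] = 0"
    "pconj K (Inl i) = 0" "one_form (pconj K b)" "pconj K b [Inr k] = 0"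
proof -
  have bd: "bidegree 0 1 (K b)" for b
    using assms by (simp add: beltrami_def)
  show Inr: "K (Inr i) = 0" for i
    using assms by (simp add: beltrami_def)
  show one: "one_form (K b)" for b
    unfolding one_form_def
  proof (intro allI impI)
    fix l :: "('a + 'a) list" assume "length l \<noteq> 1"
    then show "K b l = 0"
      using bd [of b] sum_length_filter_compl [of isl l] unfolding bidegree_def by (metis add_0)
  qed
  show Inl: "K b [Inl k] = 0" for b k
    using bd [of b] unfolding bidegree_def by fastforce
  show "pconj K (Inl i) = 0"
    by (auto simp: pconj_def bar_def Inr pointwise)
  show "one_form (pconj K b)"
    using one [of "bar b"] by (simp add: one_form_def pconj_def)
  show "pconj K b [Inr k] = 0"
    using Inl [of "bar b" k] by (simp add: pconj_def bar_def)
qed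

text \<open>The form part of \<open>K\<close> is of type (0,1) while its vectors are of type (1,0),
  so nothing is left to contract; conjugately for \<open>pconj K\<close>. This is the nilpotency
  that \<open>pexp_wedge_list\<close> asks for.\<close>

lemma pcontract_beltrami:
  assumes "beltrami K"
  shows "pcontract K (K b) = 0" "pcontract (pconj K) (pconj K b) = 0"
  by (simp_all add: pcontract_one_form beltramiD [OF assms] sum_UNIV_Plus)

lemma pull_frame_coframe:
  assumes "beltrami K"
  shows "pull (frame K) (coframe (Inl i)) = coframe (Inl i) + K (Inl i)"
    "pull (frame K) (coframe (Inr i)) = coframe (Inr i) + pconj K (Inr i)"
  by (rule one_form_eqI; simp add: one_form_pull one_form_intros beltramiD [OF assms] pull_coframe frame_def
      plus_fun_apply zero_fun_apply del: pull.simps)+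

definition component :: "nat \<Rightarrow> nat \<Rightarrow> 'n pform \<Rightarrow> 'n pform" where
  "component p q \<alpha> = (\<lambda>l. if length (filter isl l) = p \<and> length (filter (\<lambda>a. \<not> isl a) l) = q then \<alpha> l else 0)"

lemma bidegree_component: "bidegree p q (component p q \<alpha>)"
  by (simp add: bidegree_def component_def)

lemma alternating_component:
  assumes "alternating \<alpha>"
  shows "alternating (component p q \<alpha>)"
  unfolding alternating_def
proof (intro allI impI)
  fix l :: "('a + 'a) list" and i j assume ij: "i < j \<and> j < length l"
  have "mset (l[i := l ! j, j := l ! i]) = mset l"
    using ij by (simp add: mset_swap)
  then have "length (filter R (l[i := l ! j, j := l ! i])) = length (filter R l)" for R
    by (metis mset_filter size_mset)
  then show "component p q \<alpha> (l[i := l ! j, j := l ! i]) = - component p q \<alpha> l"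
    using assms ij by (simp add: component_def alternating_def)
qed

text \<open>An alternating form vanishes on lists with a repetition. Hence at most n arguments of
  each kind occur in a nonzero value, and the bounded sums reach every type.\<close>

lemma sum_component:
  fixes \<alpha> :: "'n::finite pform"
  assumes "alternating \<alpha>"
  shows "(\<Sum>p\<le>CARD('n). \<Sum>q\<le>CARD('n). component p q \<alpha>) = \<alpha>"
proof
  fix l :: "('n + 'n) list"
  let ?p = "length (filter isl l)" and ?q = "length (filter (\<lambda>a. \<not> isl a) l)"
  have *: "(\<Sum>q\<le>CARD('n). component p q \<alpha> l) = (if p = ?p \<and> ?q \<le> CARD('n) then \<alpha> l else 0)" for p
  proof -
    have "component p q \<alpha> l = (if q = ?q then if p = ?p then \<alpha> l else 0 else 0)" for q
      by (auto simp: component_def)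
    then show ?thesis by simp
  qed
  have "(\<Sum>p\<le>CARD('n). \<Sum>q\<le>CARD('n). component p q \<alpha>) l
      = (\<Sum>p\<le>CARD('n). if p = ?p then if ?q \<le> CARD('n) then \<alpha> l else 0 else 0)"
    unfolding sum_fun_apply * by (intro sum.cong) auto
  also have "\<dots> = (if ?p \<le> CARD('n) \<and> ?q \<le> CARD('n) then \<alpha> l else 0)"
    by simp
  also have "\<dots> = \<alpha> l"
  proof (cases "distinct l")
    case True
    have "?p = card (set (filter isl l))" "?q = card (set (filter (\<lambda>a. \<not> isl a) l))"
      using True by (metis distinct_card distinct_filter)+
    moreover have "set (filter isl l) \<subseteq> range Inl" "set (filter (\<lambda>a. \<not> isl a) l) \<subseteq> range Inr"
      by (auto simp: isl_def image_iff) (metis sum.exhaust)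
    then have "card (set (filter isl l)) \<le> card (range (Inl :: 'n \<Rightarrow> 'n + 'n))"
      "card (set (filter (\<lambda>a. \<not> isl a) l)) \<le> card (range (Inr :: 'n \<Rightarrow> 'n + 'n))"
      by (intro card_mono; simp)+
    ultimately show ?thesis
      by (simp add: card_image)
  qed (use alternating_distinct [OF assms] in auto)
  finally show "(\<Sum>p\<le>CARD('n). \<Sum>q\<le>CARD('n). component p q \<alpha>) l = \<alpha> l" .
qed

text \<open>Both exponentials turn a monomial in the coframe into the product of the images of its
  factors, as \<open>pull\<close> does. \<open>pextend\<close> reads coefficients only at lists with
  the holomorphic indices first, and by \<open>expand_bidegree\<close> these determine every
  component of \<omega>.\<close>

lemma pextend_eq_pull:
  fixes K :: "'n::finite pvform"
  assumes K: "beltrami K" and \<omega>: "alternating \<omega>"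
  shows "pextend K \<omega> = pull (frame K) \<omega>"
proof -
  let ?P = "frame K"
  let ?W = "\<lambda>is js. wedge_list (map coframe (map Inl is @ map Inr js))"
  have 1: "pexp K (wedge_list (map (\<lambda>i. coframe (Inl i)) is)) = wedge_list (map (pull ?P) (map coframe (map Inl is)))" for "is"
    by (subst pexp_wedge_list)
      (auto simp: beltramiD [OF K] pcontract_coframe pcontract_beltrami [OF K] pull_frame_coframe [OF K] o_def)
  have 2: "pexp (pconj K) (wedge_list (map (\<lambda>j. coframe (Inr j)) js)) = wedge_list (map (pull ?P) (map coframe (map Inr js)))" for js
    by (subst pexp_wedge_list)
      (auto simp: beltramiD [OF K] pcontract_coframe pcontract_beltrami [OF K] pull_frame_coframe [OF K] o_def)
  have 3: "wedge (pexp K (wedge_list (map (\<lambda>i. coframe (Inl i)) is)))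
      (pexp (pconj K) (wedge_list (map (\<lambda>j. coframe (Inr j)) js))) = pull ?P (?W is js)" for "is" js
    unfolding 1 2 by (simp only: wedge_list_append pull_wedge_list pull_wedge map_append)
  have "pextend K \<omega> = (\<Sum>p\<le>CARD('n). \<Sum>q\<le>CARD('n). \<Sum>is | length is = p. \<Sum>js | length js = q.
      scale (1 / (fact p * fact q) * \<omega> (map Inl is @ map Inr js)) (pull ?P (?W is js)))"
    unfolding pextend_def 3 by (intro ext) (simp only: sum_fun_apply scale_apply)
  also have "\<dots> = (\<Sum>p\<le>CARD('n). \<Sum>q\<le>CARD('n). pull ?P (component p q \<omega>))"
  proof (intro sum.cong refl)
    fix p q
    have c: "component p q \<omega> (map Inl is @ map Inr js) = \<omega> (map Inl is @ map Inr js)"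
      if "length is = p" "length js = q" for "is" js
      using that by (simp add: component_def filter_map o_def)
    have "pull ?P (component p q \<omega>) = (\<Sum>is | length is = p. \<Sum>js | length js = q.
      scale (1 / (fact p * fact q) * component p q \<omega> (map Inl is @ map Inr js)) (pull ?P (?W is js)))"
      by (subst expand_bidegree [OF alternating_component [OF \<omega>] bidegree_component])
        (simp only: pull_sum pull_scale)
    also have "\<dots> = (\<Sum>is | length is = p. \<Sum>js | length js = q.
      scale (1 / (fact p * fact q) * \<omega> (map Inl is @ map Inr js)) (pull ?P (?W is js)))"
      using c by (intro sum.cong refl) simp
    finally show "(\<Sum>is | length is = p. \<Sum>js | length js = q.
      scale (1 / (fact p * fact q) * \<omega> (map Inl is @ map Inr js)) (pull ?P (?W is js))) = pull ?P (component p q \<omega>)"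
      by simp
  qed
  also have "\<dots> = pull ?P \<omega>"
    by (simp only: pull_sum [symmetric] sum_component [OF \<omega>])
  finally show ?thesis .
qed

section \<open>Wirtinger derivatives of forms\<close>

lemma has_derivative_frechet:
  "f differentiable (at z) \<Longrightarrow> (f has_derivative frechet_derivative f (at z)) (at z)"
  by (simp add: frechet_derivative_works)

lemma wirtinger_add:
  assumes "f differentiable (at z)" "g differentiable (at z)"
  shows "wirtinger a (\<lambda>z. f z + g z) z = wirtinger a f z + wirtinger a g z"
proof -
  have "frechet_derivative (\<lambda>z. f z + g z) (at z) = (\<lambda>h. frechet_derivative f (at z) h + frechet_derivative g (at z) h)"
    by (rule frechet_derivative_at [symmetric]) (intro has_derivative_add has_derivative_frechet assms)
  then show ?thesis
    by (simp add: wirtinger_def Let_def algebra_simps add_divide_distrib diff_divide_distrib split: sum.split)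
qed

lemma wirtinger_const [simp]: "wirtinger a (\<lambda>z. c) z = 0"
proof -
  have "frechet_derivative (\<lambda>z. c) (at z) = (\<lambda>h. 0)"
    by (rule frechet_derivative_at [symmetric]) simp
  then show ?thesis
    by (simp add: wirtinger_def split: sum.split)
qed

lemma wirtinger_mult:
  assumes "f differentiable (at z)" "g differentiable (at z)"
  shows "wirtinger a (\<lambda>z. f z * g z) z = wirtinger a f z * g z + f z * wirtinger a g z"
proof -
  have "frechet_derivative (\<lambda>z. f z * g z) (at z) = (\<lambda>h. f z * frechet_derivative g (at z) h + frechet_derivative f (at z) h * g z)"
    by (rule frechet_derivative_at [symmetric]) (intro has_derivative_mult has_derivative_frechet assms)
  then show ?thesis
    by (simp add: wirtinger_def Let_def algebra_simps add_divide_distrib diff_divide_distrib split: sum.split)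
qed

lemma differentiable_cnj:
  assumes "f differentiable (at z)"
  shows "(\<lambda>z. cnj (f z)) differentiable (at z)"
  using bounded_linear.has_derivative [OF bounded_linear_cnj has_derivative_frechet [OF assms]]
  by (auto simp: differentiable_def)

lemma wirtinger_cnj:
  assumes "f differentiable (at z)"
  shows "wirtinger a (\<lambda>z. cnj (f z)) z = cnj (wirtinger (bar a) f z)"
proof -
  have "frechet_derivative (\<lambda>z. cnj (f z)) (at z) = (\<lambda>h. cnj (frechet_derivative f (at z) h))"
    by (rule frechet_derivative_at [symmetric])
      (rule bounded_linear.has_derivative [OF bounded_linear_cnj has_derivative_frechet [OF assms]])
  then show ?thesis
    by (simp add: wirtinger_def Let_def bar_def split: sum.split)
qed

lemma wirtinger_sum:
  assumes "\<And>i. i \<in> I \<Longrightarrow> f i differentiable (at z)"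
  shows "wirtinger a (\<lambda>z. \<Sum>i\<in>I. f i z) z = (\<Sum>i\<in>I. wirtinger a (f i) z)"
  using assms
proof (induction I rule: infinite_finite_induct)
  case (insert i I)
  then have "wirtinger a (\<lambda>z. f i z + (\<Sum>i\<in>I. f i z)) z = wirtinger a (f i) z + wirtinger a (\<lambda>z. \<Sum>i\<in>I. f i z) z"
    by (intro wirtinger_add) (auto intro!: differentiable_sum)
  with insert show ?case by simp
qed auto

text \<open>A derivative depends only on the germ. This lets identities that hold near a point, such
  as vanishing of coefficients for reasons of type, be differentiated.\<close>

lemma wirtinger_cong:
  assumes "open S" "z \<in> S" "\<And>y. y \<in> S \<Longrightarrow> f y = g y"
  shows "wirtinger a f z = wirtinger a g z"
proof -
  have "(f has_derivative D) (at z) \<longleftrightarrow> (g has_derivative D) (at z)" for D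
    using has_derivative_transform_within_open [OF _ assms(1,2), where f = f and g = g and f' = D]
      has_derivative_transform_within_open [OF _ assms(1,2), where f = g and g = f and f' = D] assms(3) by fastforce
  then have "frechet_derivative f (at z) = frechet_derivative g (at z)"
    by (simp add: frechet_derivative_def)
  then show ?thesis
    by (simp add: wirtinger_def)
qed

section \<open>Coefficientwise derivatives of form-valued functions\<close>

definition differentiable_form :: "(complex ^ 'n::finite \<Rightarrow> 'n pform) \<Rightarrow> complex ^ 'n \<Rightarrow> bool" where
  "differentiable_form W z \<longleftrightarrow> (\<forall>l. (\<lambda>y. W y l) differentiable (at z))"

definition form_deriv :: "'n::finite + 'n \<Rightarrow> (complex ^ 'n \<Rightarrow> 'n pform) \<Rightarrow> complex ^ 'n \<Rightarrow> 'n pform" where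
  "form_deriv a W z = (\<lambda>l. wirtinger a (\<lambda>y. W y l) z)"

lemma differentiable_form_ip: "differentiable_form W z \<Longrightarrow> differentiable_form (\<lambda>y. ip b (W y)) z"
  by (simp add: differentiable_form_def ip_apply)

lemma form_deriv_ip: "form_deriv a (\<lambda>y. ip b (W y)) z = ip b (form_deriv a W z)"
  by (simp add: form_deriv_def fun_eq_iff ip_apply)

lemma one_form_form_deriv:
  assumes "open S" "z \<in> S" "\<And>y. y \<in> S \<Longrightarrow> one_form (\<kappa> y)"
  shows "one_form (form_deriv a \<kappa> z)"
  unfolding one_form_def
proof (intro allI impI)
  fix l :: "('a + 'a) list" assume "length l \<noteq> 1"
  then have "wirtinger a (\<lambda>y. \<kappa> y l) z = wirtinger a (\<lambda>y. 0) z"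
    using assms by (intro wirtinger_cong [of S]) (auto simp: one_form_def)
  then show "form_deriv a \<kappa> z l = 0"
    by (simp add: form_deriv_def)
qed

lemma bidegree_form_deriv:
  assumes "open S" "z \<in> S" "\<And>y. y \<in> S \<Longrightarrow> bidegree p q (W y)"
  shows "bidegree p q (form_deriv a W z)"
  unfolding bidegree_def
proof (intro allI impI, rule ccontr)
  fix l assume l: "form_deriv a W z l \<noteq> 0" "\<not> (length (filter isl l) = p \<and> length (filter (\<lambda>a. \<not> isl a) l) = q)"
  then have "wirtinger a (\<lambda>y. W y l) z = wirtinger a (\<lambda>y. 0) z"
    using assms by (intro wirtinger_cong [of S]) (auto simp: bidegree_def)
  then show False
    using l by (simp add: form_deriv_def)
qed

lemma alternating_form_deriv:
  assumes "open S" "z \<in> S" "\<And>y. y \<in> S \<Longrightarrow> alternating (W y)" "differentiable_form W z"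
  shows "alternating (form_deriv a W z)"
  unfolding alternating_def
proof (intro allI impI)
  fix l :: "('a + 'a) list" and i j assume ij: "i < j \<and> j < length l"
  have "wirtinger a (\<lambda>y. W y (l[i := l ! j, j := l ! i])) z = wirtinger a (\<lambda>y. (- 1) * W y l) z"
    using assms ij by (intro wirtinger_cong [of S]) (auto simp: alternating_def)
  also have "\<dots> = - wirtinger a (\<lambda>y. W y l) z"
    using assms(4) by (subst wirtinger_mult) (auto simp: differentiable_form_def)
  finally show "form_deriv a W z (l[i := l ! j, j := l ! i]) = - form_deriv a W z l"
    by (simp add: form_deriv_def)
qed

lemma differentiable_form_wedge:
  assumes "differentiable_form A z" "differentiable_form B z"
  shows "differentiable_form (\<lambda>y. wedge (A y) (B y)) z"
  using assms unfolding differentiable_form_def wedge_def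
  by (intro allI differentiable_sum differentiable_mult) auto

lemma form_deriv_wedge:
  assumes "differentiable_form A z" "differentiable_form B z"
  shows "form_deriv a (\<lambda>y. wedge (A y) (B y)) z = wedge (form_deriv a A z) (B z) + wedge (A z) (form_deriv a B z)"
proof
  fix l
  have A: "(\<lambda>y. A y l) differentiable (at z)" and B: "(\<lambda>y. B y l) differentiable (at z)" for l
    using assms by (auto simp: differentiable_form_def)
  show "form_deriv a (\<lambda>y. wedge (A y) (B y)) z l = (wedge (form_deriv a A z) (B z) + wedge (A z) (form_deriv a B z)) l"
    unfolding form_deriv_def wedge_def plus_fun_apply
    by (simp add: wirtinger_sum wirtinger_mult A B sum.distrib [symmetric] distrib_left mult.assoc)
qed

lemma form_deriv_sum:
  assumes "\<And>i. i \<in> I \<Longrightarrow> differentiable_form (\<lambda>y. W i y) z"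
  shows "form_deriv a (\<lambda>y. \<Sum>i\<in>I. W i y) z = (\<Sum>i\<in>I. form_deriv a (W i) z)"
  using assms unfolding form_deriv_def sum_fun_apply fun_eq_iff differentiable_form_def
  by (simp add: wirtinger_sum)

text \<open>Differentiating a family of algebra endomorphisms gives a derivation along it: one
  factor \<open>coframe c\<close> at a time is replaced by the derivative \<open>\<Theta> c\<close>
  of its image, and alternation brings this factor to the front.\<close>

lemma form_deriv_pull:
  fixes P :: "complex ^ 'n \<Rightarrow> 'n::finite + 'n \<Rightarrow> 'n + 'n \<Rightarrow> complex" and z :: "complex ^ 'n"
    and a :: "'n + 'n"
  defines "\<Theta> \<equiv> \<lambda>c l. case l of [b] \<Rightarrow> wirtinger a (\<lambda>y. P y c b) z | _ \<Rightarrow> 0"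
  assumes P: "\<And>a b. (\<lambda>y. P y a b) differentiable (at z)"
    and W: "differentiable_form W z" "alternating (W z)"
  shows "differentiable_form (\<lambda>y. pull (P y) (W y)) z"
    and "form_deriv a (\<lambda>y. pull (P y) (W y)) z
      = pull (P z) (form_deriv a W z) + (\<Sum>c\<in>UNIV. wedge (\<Theta> c) (pull (P z) (ip c (W z))))"
proof -
  have \<Theta>b: "\<Theta> c [b] = wirtinger a (\<lambda>y. P y c b) z" for c b
    by (simp add: \<Theta>_def)
  have one: "one_form (\<Theta> c)" for c
    by (auto simp: one_form_def \<Theta>_def split: list.split)
  have "(\<lambda>y. pull (P y) (W y) l) differentiable (at z) \<and> wirtinger a (\<lambda>y. pull (P y) (W y) l) z
     = (pull (P z) (form_deriv a W z) + (\<Sum>c\<in>UNIV. wedge (\<Theta> c) (pull (P z) (ip c (W z))))) l" for l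
    using W
  proof (induction l arbitrary: W)
    case Nil
    then show ?case
      by (simp add: differentiable_form_def pointwise sum_fun_apply form_deriv_def \<Theta>_def)
  next
    case (Cons b l)
    have IH: "(\<lambda>y. pull (P y) (ip c (W y)) l) differentiable (at z)"
       "wirtinger a (\<lambda>y. pull (P y) (ip c (W y)) l) z
     = pull (P z) (ip c (form_deriv a W z)) l + (\<Sum>e\<in>UNIV. wedge (\<Theta> e) (pull (P z) (ip e (ip c (W z)))) l)" for c
      using Cons.IH [OF differentiable_form_ip alternating_ip, of W c] Cons.prems
      by (auto simp: form_deriv_ip pointwise sum_fun_apply)
    have "wirtinger a (\<lambda>y. pull (P y) (W y) (b # l)) z
      = (\<Sum>c\<in>UNIV. wirtinger a (\<lambda>y. P y c b) z * pull (P z) (ip c (W z)) l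
         + P z c b * (pull (P z) (ip c (form_deriv a W z)) l + (\<Sum>e\<in>UNIV. wedge (\<Theta> e) (pull (P z) (ip e (ip c (W z)))) l)))"
      by (simp add: wirtinger_sum wirtinger_mult P IH)
    also have "\<dots> = ip b (pull (P z) (form_deriv a W z) + (\<Sum>c\<in>UNIV. wedge (\<Theta> c) (pull (P z) (ip c (W z))))) l"
    proof -
      \<comment> \<open>The sign that arises when an interior product passes
        \<open>\<Theta> e\<close> is cancelled by exchanging two interior products of
        \<open>W z\<close>; this is where alternation enters.\<close>
      have anti: "wedge (\<Theta> e) (pull (P z) (ip c (ip e (W z)))) = - wedge (\<Theta> e) (pull (P z) (ip e (ip c (W z))))" for c e
        by (subst alternating_ip_ip [OF Cons.prems(2)]) (simp add: pull_uminus wedge_uminus_right)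
      have "ip b (wedge (\<Theta> e) (pull (P z) (ip e (W z))))
          = scale (wirtinger a (\<lambda>y. P y e b) z) (pull (P z) (ip e (W z)))
            + (\<Sum>c\<in>UNIV. scale (P z c b) (wedge (\<Theta> e) (pull (P z) (ip e (ip c (W z))))))" for e
      proof -
        have "scale k (- \<alpha>) = - scale k \<alpha>" for k and \<alpha> :: "'n pform"
          by (simp add: scale_def fun_eq_iff)
        then show ?thesis
          unfolding ip_wedge_one_form [OF one] ip_pull
          by (simp add: wedge_sum_right wedge_scale_right anti sum_negf \<Theta>b)
      qed
      then have "ip b (pull (P z) (form_deriv a W z) + (\<Sum>c\<in>UNIV. wedge (\<Theta> c) (pull (P z) (ip c (W z)))))
          = (\<Sum>c\<in>UNIV. scale (P z c b) (pull (P z) (ip c (form_deriv a W z))))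
          + ((\<Sum>c\<in>UNIV. scale (wirtinger a (\<lambda>y. P y c b) z) (pull (P z) (ip c (W z))))
          + (\<Sum>e\<in>UNIV. \<Sum>c\<in>UNIV. scale (P z c b) (wedge (\<Theta> e) (pull (P z) (ip e (ip c (W z)))))))"
        by (simp only: ip_simps ip_pull sum.distrib)
      also have "(\<Sum>e\<in>UNIV. \<Sum>c\<in>UNIV. scale (P z c b) (wedge (\<Theta> e) (pull (P z) (ip e (ip c (W z))))))
          = (\<Sum>c\<in>UNIV. scale (P z c b) (\<Sum>e\<in>UNIV. wedge (\<Theta> e) (pull (P z) (ip e (ip c (W z))))))"
        by (subst sum.swap) (simp only: scale_sum)
      finally have eq: "ip b (pull (P z) (form_deriv a W z) + (\<Sum>c\<in>UNIV. wedge (\<Theta> c) (pull (P z) (ip c (W z)))))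
          = (\<Sum>c\<in>UNIV. scale (P z c b) (pull (P z) (ip c (form_deriv a W z))))
          + ((\<Sum>c\<in>UNIV. scale (wirtinger a (\<lambda>y. P y c b) z) (pull (P z) (ip c (W z))))
          + (\<Sum>c\<in>UNIV. scale (P z c b) (\<Sum>e\<in>UNIV. wedge (\<Theta> e) (pull (P z) (ip e (ip c (W z)))))))" .
      show ?thesis
        unfolding eq by (simp add: plus_fun_apply sum_fun_apply scale_apply sum.distrib distrib_left)
    qed
    finally show ?case
      using P IH(1) by (simp add: ip_apply [of b])
  qed
  then show "differentiable_form (\<lambda>y. pull (P y) (W y)) z"
    and "form_deriv a (\<lambda>y. pull (P y) (W y)) z
      = pull (P z) (form_deriv a W z) + (\<Sum>c\<in>UNIV. wedge (\<Theta> c) (pull (P z) (ip c (W z))))"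
    by (auto simp: differentiable_form_def form_deriv_def)
qed

section \<open>Deformed frames\<close>

text \<open>Interior products carry antisymmetry in the first two arguments down the list to any
  adjacent pair, and adjacent transpositions generate all others. The set \<open>A\<close> serves as
  the invariant of this descent.\<close>

lemma alternating_closed_set:
  assumes ip: "\<And>\<alpha> b. \<alpha> \<in> A \<Longrightarrow> ip b \<alpha> \<in> A"
    and anti: "\<And>\<alpha> a b. \<alpha> \<in> A \<Longrightarrow> ip a (ip b \<alpha>) = - ip b (ip a \<alpha>)"
    and \<alpha>: "\<alpha> \<in> A"
  shows "alternating \<alpha>"
proof -
  have anti': "\<alpha> (a # b # l) = - \<alpha> (b # a # l)" if "\<alpha> \<in> A" for \<alpha> a b l
    using fun_cong [OF anti [OF that, of b a], of l] by (simp add: ip_apply)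
  \<comment> \<open>The transposition (0 j) is the composition (0 1)(1 j)(0 1), hence three changes
    of sign; the middle one is the induction hypothesis applied to
    \<open>ip b \<alpha>\<close>.\<close>
  have swap_first: "\<alpha> (l[0 := l ! j, j := l ! 0]) = - \<alpha> l" if "0 < j" "j < length l" "\<alpha> \<in> A" for j l \<alpha>
    using that
  proof (induction j arbitrary: l \<alpha>)
    case (Suc j)
    then obtain a b l' where l: "l = a # b # l'"
      by (cases l rule: remdups_adj.cases) auto
    show ?case
    proof (cases j)
      case 0
      then show ?thesis
        using anti' [OF Suc.prems(3), of a b l'] by (simp add: l)
    next
      case (Suc i)
      have "ip b \<alpha> ((a # l')[0 := (a # l') ! j, j := (a # l') ! 0]) = - ip b \<alpha> (a # l')"
        using Suc.prems Suc by (intro Suc.IH ip) (auto simp: l)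
      then have "\<alpha> (b # (l' ! i) # l'[i := a]) = - \<alpha> (b # a # l')"
        by (simp add: Suc ip_apply)
      then have "\<alpha> ((l' ! i) # b # l'[i := a]) = - \<alpha> (a # b # l')"
        using anti' [OF Suc.prems(3), of "l' ! i" b "l'[i := a]"] anti' [OF Suc.prems(3), of a b l'] by simp
      then show ?thesis
        by (simp add: l Suc)
    qed
  qed simp
  have "\<alpha> (l[i := l ! j, j := l ! i]) = - \<alpha> l" if "i < j" "j < length l" "\<alpha> \<in> A" for i j l \<alpha>
    using that
  proof (induction i arbitrary: j l \<alpha>)
    case 0
    then show ?case by (intro swap_first) auto
  next
    case (Suc i)
    then obtain b l' j' where l: "l = b # l'" "j = Suc j'"
      by (metis Suc_lessE length_0_conv list.exhaust not_less_zero)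
    show ?case
      using Suc.IH [of j' l' "ip b \<alpha>", OF _ _ ip [OF Suc.prems(3)]] Suc.prems by (simp add: l ip_apply)
  qed
  then show ?thesis
    using \<alpha> by (auto simp: alternating_def)
qed

lemma alternating_zero: "alternating 0"
  and alternating_add: "alternating \<alpha> \<Longrightarrow> alternating \<beta> \<Longrightarrow> alternating (\<alpha> + \<beta>)"
  and alternating_uminus: "alternating \<alpha> \<Longrightarrow> alternating (- \<alpha>)"
  and alternating_scale: "alternating \<alpha> \<Longrightarrow> alternating (scale k \<alpha>)"
  by (auto simp: alternating_def pointwise scale_apply)

lemma alternating_sum: "(\<And>i. i \<in> I \<Longrightarrow> alternating (f i)) \<Longrightarrow> alternating (\<Sum>i\<in>I. f i)"
  by (induction I rule: infinite_finite_induct) (auto simp: alternating_zero alternating_add)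

lemma alternating_wedge_one_form:
  assumes "one_form \<kappa>" "alternating \<beta>"
  shows "alternating (wedge \<kappa> \<beta>)"
\<comment> \<open>An interior product of \<open>wedge \<kappa> \<beta>\<close> also produces a
  multiple of \<beta> alone, so the closed set must admit an extra alternating summand
  \<gamma>.\<close>
proof (rule alternating_closed_set [where A = "{wedge \<kappa> \<beta> + \<gamma> | \<beta> \<gamma>. alternating \<beta> \<and> alternating \<gamma>}"])
  fix \<alpha> a b
  assume "\<alpha> \<in> {wedge \<kappa> \<beta> + \<gamma> | \<beta> \<gamma>. alternating \<beta> \<and> alternating \<gamma>}"
  then obtain \<beta> \<gamma> where \<alpha>: "\<alpha> = wedge \<kappa> \<beta> + \<gamma>" and alt: "alternating \<beta>" "alternating \<gamma>"
    by auto
  have "ip b \<alpha> = wedge \<kappa> (- ip b \<beta>) + (scale (\<kappa> [b]) \<beta> + ip b \<gamma>)"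
    by (simp add: \<alpha> ip_simps ip_wedge_one_form [OF assms(1)] wedge_uminus_right)
  then show "ip b \<alpha> \<in> {wedge \<kappa> \<beta> + \<gamma> | \<beta> \<gamma>. alternating \<beta> \<and> alternating \<gamma>}"
    using alt by (auto intro!: exI alternating_uminus alternating_add alternating_scale alternating_ip)
  have "ip a (ip b \<beta>) = - ip b (ip a \<beta>)" "ip a (ip b \<gamma>) = - ip b (ip a \<gamma>)"
    using alternating_ip_ip alt by blast+
  then show "ip a (ip b \<alpha>) = - ip b (ip a \<alpha>)"
    by (simp add: \<alpha> ip_simps ip_wedge_one_form [OF assms(1)] wedge_uminus_right algebra_simps)
next
  show "wedge \<kappa> \<beta> \<in> {wedge \<kappa> \<beta> + \<gamma> | \<beta> \<gamma>. alternating \<beta> \<and> alternating \<gamma>}"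
    using assms(2) alternating_zero by (metis (mono_tags, lifting) add.right_neutral mem_Collect_eq)
qed

lemma ip_Inl_bidegree_0:
  assumes "bidegree 0 q \<alpha>"
  shows "ip (Inl i) \<alpha> = 0"
proof
  show "ip (Inl i) \<alpha> l = 0 l" for l
    using assms [unfolded bidegree_def, rule_format, of "Inl i # l"] by (auto simp: ip_apply pointwise)
qed

section \<open>The inverses of 1 - \<phi>\<psi> and 1 - \<psi>\<phi>, and preimages of the
  coframe\<close>

lemma invertible_matrix_inv:
  assumes "invertible A"
  shows "A ** matrix_inv A = mat 1" "matrix_inv A ** A = mat 1"
  using someI_ex [OF assms [unfolded invertible_def]] by (auto simp: matrix_inv_def)

text \<open>The situation at one point: \<open>K\<close> is \<phi> and \<open>L\<close> its
  conjugate, \<open>M\<close> and \<open>N\<close> invert 1 - KL and 1 - LK, \<open>G\<close> and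
  \<open>H\<close> are these inverses as vector-valued 1-forms, and \<open>F\<close> is the product
  of K with the inverse of 1 - LK.\<close>

context
  fixes K L G H F :: "'n::finite pvform" and M N :: "complex ^ 'n ^ 'n"
  assumes K: "beltrami K"
    and M: "invertible (mat10 (of_mat10 (mat 1) - (\<lambda>b. pcontract (pconj K) (K b))))"
    and N: "invertible (mat01 (of_mat01 (mat 1) - (\<lambda>b. pcontract K (pconj K b))))"
  defines "L \<equiv> pconj K"
    and "M \<equiv> matrix_inv (mat10 (of_mat10 (mat 1) - (\<lambda>b. pcontract (pconj K) (K b))))"
    and "N \<equiv> matrix_inv (mat01 (of_mat01 (mat 1) - (\<lambda>b. pcontract K (pconj K b))))"
    and "G \<equiv> of_mat10 M"
    and "H \<equiv> of_mat01 N"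
    and "F \<equiv> \<lambda>b. pcontract H (K b)"
begin

text \<open>Rows are vector components and columns are form indices, so that matrix products are
  compositions of endomorphisms.\<close>

private definition f where "f = (\<chi> i k. K (Inl i) [Inr k])"
private definition fb where "fb = (\<chi> i k. L (Inr i) [Inl k])"

private lemma mats:
  "mat10 (of_mat10 (mat 1) - (\<lambda>b. pcontract (pconj K) (K b))) = mat 1 - f ** fb"
  "mat01 (of_mat01 (mat 1) - (\<lambda>b. pcontract K (pconj K b))) = mat 1 - fb ** f"
  by (auto simp: vec_eq_iff mat10_def of_mat10_def mat01_def of_mat01_def mat_def matrix_matrix_mult_def
      pcontract_one_form beltramiD [OF K] sum_fun_apply scale_apply sum_UNIV_Plus pointwise f_def fb_def L_def)

private lemma inv:
  "M ** (mat 1 - f ** fb) = mat 1" "(mat 1 - f ** fb) ** M = mat 1"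
  "N ** (mat 1 - fb ** f) = mat 1" "(mat 1 - fb ** f) ** N = mat 1"
  using invertible_matrix_inv [OF M] invertible_matrix_inv [OF N] by (simp_all add: M_def N_def mats)

private lemma diff_mult: "A ** (B - C) = A ** B - A ** C" "(B - C) ** A = B ** A - C ** A"
  for A B C :: "complex ^ 'n ^ 'n"
  by (simp_all add: vec_eq_iff matrix_matrix_mult_def algebra_simps sum_subtractf)

private lemma inv_eq:
  "M = mat 1 + M ** f ** fb"
  "N = mat 1 + N ** fb ** f" "N = mat 1 + fb ** f ** N"
  using inv by (simp_all add: diff_mult matrix_mul_assoc algebra_simps)

text \<open>Push-through identity: f (1 - fb f) = (1 - f fb) f, multiplied by \<open>M\<close> on
  the left and \<open>N\<close> on the right; likewise with the roles exchanged.\<close>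

private lemma commute: "M ** f = f ** N" "N ** fb = fb ** M"
proof -
  have "M ** f = M ** f ** ((mat 1 - fb ** f) ** N)"
    by (simp add: inv)
  also have "\<dots> = (M ** (mat 1 - f ** fb)) ** f ** N"
    by (simp add: diff_mult matrix_mul_assoc)
  finally show "M ** f = f ** N"
    by (simp add: inv)
  have "N ** fb = N ** fb ** ((mat 1 - f ** fb) ** M)"
    by (simp add: inv)
  also have "\<dots> = (N ** (mat 1 - fb ** f)) ** fb ** M"
    by (simp add: diff_mult matrix_mul_assoc)
  finally show "N ** fb = fb ** M"
    by (simp add: inv)
qed

private lemma vforms:
  "one_form (G b)" "one_form (H b)" "G (Inr i) = 0" "H (Inl i) = 0"
  "G (Inl i) [Inl j] = M $ i $ j" "G (Inl i) [Inr j] = 0"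
  "H (Inr i) [Inr j] = N $ i $ j" "H (Inr i) [Inl j] = 0"
  by (auto simp: one_form_def G_def H_def of_mat10_def of_mat01_def pointwise split: sum.split list.split)

private lemma L:
  "one_form (L b)" "L (Inl i) = 0" "L b [Inr k] = 0" "L (Inr j) [Inl k] = fb $ j $ k"
  by (auto simp: L_def fb_def beltramiD [OF K])

private lemma F:
  "one_form (F b)" "F (Inr i) = 0" "F b [Inl k] = 0" "F (Inl i) [Inr k] = (f ** N) $ i $ k"
  by (auto simp: F_def pcontract_one_form beltramiD [OF K] sum_UNIV_Plus vforms one_form_sum one_form_intros
      sum_fun_apply pointwise scale_apply matrix_matrix_mult_def f_def pcontract_simps)

text \<open>In matrices, fb f N = N - 1, a rearrangement of (1 - fb f) N = 1. The coframe subtracted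
  here is the origin of the term with the factor q.\<close>

private lemma F_L: "pcontract F (L (Inr j)) = H (Inr j) - coframe (Inr j)"
proof (rule one_form_eqI)
  have "fb ** (f ** N) = N - mat 1"
    using inv_eq(3) by (metis add_diff_cancel_left' matrix_mul_assoc)
  then have *: "(\<Sum>i\<in>UNIV. fb $ j $ i * (f ** N) $ i $ k) = N $ j $ k - (if j = k then 1 else 0)" for k
    by (simp add: vec_eq_iff matrix_matrix_mult_def [of fb] mat_def)
  show "pcontract F (L (Inr j)) [b] = (H (Inr j) - coframe (Inr j)) [b]" for b
    by (cases b) (auto simp: pcontract_one_form L F sum_UNIV_Plus sum_fun_apply scale_apply vforms pointwise * coframe_apply)
qed (auto simp: pcontract_one_form L F one_form_sum one_form_intros vforms)

private lemma pull_frame_one_form: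
  assumes "one_form \<kappa>"
  shows "pull (frame K) \<kappa> [Inl m] = \<kappa> [Inl m] + (\<Sum>j\<in>UNIV. fb $ j $ m * \<kappa> [Inr j])"
    "pull (frame K) \<kappa> [Inr m] = \<kappa> [Inr m] + (\<Sum>i\<in>UNIV. f $ i $ m * \<kappa> [Inl i])"
proof -
  have "x * (if b then 1 else 0) = (if b then x else 0)" "(if b then 1 else 0) * x = (if b then x else 0)"
    for x :: complex and b
    by auto
  then show "pull (frame K) \<kappa> [Inl m] = \<kappa> [Inl m] + (\<Sum>j\<in>UNIV. fb $ j $ m * \<kappa> [Inr j])"
    "pull (frame K) \<kappa> [Inr m] = \<kappa> [Inr m] + (\<Sum>i\<in>UNIV. f $ i $ m * \<kappa> [Inl i])"
    by (simp_all add: pull_one_form [OF assms] sum_UNIV_Plus frame_def coframe_apply beltramiD [OF K] f_def fb_def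
        L_def distrib_right sum.distrib pointwise del: pull.simps)
qed

text \<open>Exhibits preimages of (1,0) one-forms. For dz^i the preimage has row i of
  \<open>M\<close> as its (1,0) part and of - f N as its (0,1) part; its image then has parts M - f
  N fb = 1 and M f - f N = 0.\<close>

private lemma pull_dz:
  assumes \<delta>: "one_form \<delta>" "\<And>k. \<delta> [Inr k] = 0"
  shows "pull (frame K) (pcontract G \<delta> - pcontract F \<delta>) = \<delta>"
proof -
  let ?g = "\<lambda>i. G (Inl i) - F (Inl i)"
  have one: "one_form (?g i)" for i
    by (intro one_form_intros vforms F)
  have g: "pull (frame K) (?g i) = coframe (Inl i)" for i
  proof (rule one_form_eqI)
    have "M - f ** N ** fb = mat 1" "M ** f = f ** N"
      using inv_eq(1) commute(1) by (metis add_diff_cancel_right') (rule commute)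
    then have 1: "M $ i $ m - (\<Sum>j\<in>UNIV. (f ** N) $ i $ j * fb $ j $ m) = (if i = m then 1 else 0)"
      and 2: "(\<Sum>j\<in>UNIV. M $ i $ j * f $ j $ m) = (f ** N) $ i $ m" for m
      by (simp_all add: vec_eq_iff matrix_matrix_mult_def [of _ fb] matrix_matrix_mult_def [of M] mat_def)
    show "pull (frame K) (?g i) [b] = coframe (Inl i) [b]" for b
      using 1 2 by (cases b)
        (simp_all add: pull_frame_one_form [OF one] vforms F coframe_apply sum_negf mult.commute del: pull.simps)
  qed (simp_all add: one_form_pull one one_form_intros)
  have "pcontract G \<delta> - pcontract F \<delta> = (\<Sum>i\<in>UNIV. scale (\<delta> [Inl i]) (?g i))"
    by (simp add: pcontract_one_form [OF \<delta>(1)] sum_UNIV_Plus \<delta>(2) scale_diff sum_subtractf)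
  then have "pull (frame K) (pcontract G \<delta> - pcontract F \<delta>) = (\<Sum>i\<in>UNIV. scale (\<delta> [Inl i]) (coframe (Inl i)))"
    by (simp add: pull_sum pull_scale g)
  also have "\<dots> = \<delta>"
  proof (rule one_form_eqI)
    have *: "\<delta> [Inl i] * (if c then 1 else 0) = (if c then \<delta> [Inl i] else 0)" for i c
      by simp
    show "(\<Sum>i\<in>UNIV. scale (\<delta> [Inl i]) (coframe (Inl i))) [b] = \<delta> [b]" for b
      by (cases b) (auto simp: sum_fun_apply scale_apply coframe_apply \<delta> *)
  qed (auto intro: one_form_sum one_form_intros \<delta>)
  finally show ?thesis .
qed

text \<open>The counterpart for the conjugate coframe: the (0,1) part of the image is N - fb M f = 1
  and the (1,0) part is N fb - fb M = 0.\<close>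

private lemma pull_dzbar:
  "pull (frame K) (H (Inr k) - pcontract G (L (Inr k))) = coframe (Inr k)"
proof (rule one_form_eqI)
  have GL: "pcontract G (L (Inr k)) [Inl m] = (fb ** M) $ k $ m" "pcontract G (L (Inr k)) [Inr m] = 0" for m
    by (simp_all add: pcontract_one_form L vforms sum_UNIV_Plus sum_fun_apply scale_apply matrix_matrix_mult_def)
  have one: "one_form (pcontract G (L (Inr k)))" 
    by (auto simp: pcontract_one_form L vforms one_form_sum one_form_intros)
  have "N - fb ** M ** f = mat 1" "N ** fb = fb ** M"
    using inv_eq(2) commute(2) by (metis add_diff_cancel_right') (rule commute)
  then have 1: "N $ k $ m - (\<Sum>j\<in>UNIV. (fb ** M) $ k $ j * f $ j $ m) = (if k = m then 1 else 0)"
    and 2: "(\<Sum>j\<in>UNIV. N $ k $ j * fb $ j $ m) = (fb ** M) $ k $ m" for m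
    by (simp_all add: vec_eq_iff matrix_matrix_mult_def [of _ f] matrix_matrix_mult_def [of N] mat_def)
  show "pull (frame K) (H (Inr k) - pcontract G (L (Inr k))) [b] = coframe (Inr k) [b]" for b
    using 1 2 by (cases b)
      (simp_all add: pull_frame_one_form one_form_intros one vforms GL coframe_apply sum_negf mult.commute del: pull.simps)
  show "one_form (pull (frame K) (H (Inr k) - pcontract G (L (Inr k))))"
    by (intro one_form_pull one_form_intros one vforms)
qed (rule one_form_intros)

private lemma pcontract_zero_bidegree:
  assumes "\<And>i. ip (Inl i) \<alpha> = 0"
  shows "pcontract G \<alpha> = 0" "pcontract F \<alpha> = 0"
  using assms by (simp_all add: pcontract_def sum_UNIV_Plus vforms F)

private lemma pcontract_L: "pcontract L \<alpha> = (\<Sum>j\<in>UNIV. wedge (L (Inr j)) (ip (Inr j) \<alpha>))"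
  by (simp add: pcontract_def sum_UNIV_Plus L)

text \<open>The (1,0) slots created by \<open>L\<close> are the only ones that \<open>F\<close> can
  contract, since the interior products of \<alpha> have none. So \<open>F_L\<close> applies summand
  by summand, and the subtracted coframes add up to q \<alpha> by Euler's identity.\<close>

private lemma pcontract_F_L:
  assumes "alternating \<alpha>" "bidegree 0 q \<alpha>"
  shows "pcontract F (pcontract L \<alpha>) = pcontract H \<alpha> - scale (of_nat q) \<alpha>"
proof -
  have "ip (Inl i) (ip (Inr j) \<alpha>) = 0" for i j
    using alternating_ip_ip [OF assms(1), of "Inl i" "Inr j"] ip_Inl_bidegree_0 [OF assms(2), of i]
    by (simp add: ip_simps)
  then have *: "pcontract F (ip (Inr j) \<alpha>) = 0" for j
    by (rule pcontract_zero_bidegree)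
  have "pcontract F (pcontract L \<alpha>) = (\<Sum>j\<in>UNIV. wedge (H (Inr j)) (ip (Inr j) \<alpha>))
      - (\<Sum>j\<in>UNIV. wedge (coframe (Inr j)) (ip (Inr j) \<alpha>))"
    by (simp add: pcontract_L pcontract_sum pcontract_wedge [OF F(1)] F_L * wedge_diff_left sum_subtractf)
  then show ?thesis
    by (simp add: euler_Inr [OF assms] pcontract_def [of H] sum_UNIV_Plus vforms)
qed

text \<open>The comparison at one point, with the derivatives abstracted: \<open>d a\<close> stands
  for a derivative of \<omega> and \<open>\<delta> k j\<close> for the derivative of
  \<open>L (Inr j)\<close> along the conjugate of the k-th coordinate vector. By the product rule
  \<open>B\<close> then stands for the delbar-derivative of
  \<open>pcontract L \<omega>\<close>.\<close>

lemma pull_rhs: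
  fixes \<omega> :: "'n pform" and d :: "'n + 'n \<Rightarrow> 'n pform" and \<delta> :: "'n \<Rightarrow> 'n \<Rightarrow> 'n pform"
  assumes \<omega>: "alternating \<omega>" "bidegree 0 q \<omega>"
    and d: "\<And>a. alternating (d a)" "\<And>a. bidegree 0 q (d a)"
    and \<delta>: "\<And>k j. one_form (\<delta> k j)" "\<And>k j m. \<delta> k j [Inr m] = 0"
  defines "dl \<equiv> \<Sum>i\<in>UNIV. wedge (coframe (Inl i)) (d (Inl i))"
    and "db \<equiv> \<Sum>k\<in>UNIV. wedge (coframe (Inr k)) (d (Inr k))"
    and "B \<equiv> \<Sum>k\<in>UNIV. wedge (coframe (Inr k)) ((\<Sum>j\<in>UNIV. wedge (\<delta> k j) (ip (Inr j) \<omega>)) + pcontract L (d (Inr k)))"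
  defines "R \<equiv> pcontract G (dl + B - pcontract L db) + pcontract H db - scale (of_nat q) db - pcontract F (dl + B)"
  shows "alternating R"
    and "pull (frame K) R = (\<Sum>a\<in>UNIV. wedge (coframe a) (pull (frame K) (d a)))
      + (\<Sum>j\<in>UNIV. wedge (\<Sum>k\<in>UNIV. wedge (pull (frame K) (coframe (Inr k))) (\<delta> k j)) (pull (frame K) (ip (Inr j) \<omega>)))"
proof -
  have ip0: "ip (Inl i) (d a) = 0" "ip (Inl i) (ip (Inr j) \<omega>) = 0" for i j a
    using ip_Inl_bidegree_0 [OF d(2)] alternating_ip_ip [OF \<omega>(1), of "Inl i" "Inr j"] ip_Inl_bidegree_0 [OF \<omega>(2), of i]
    by (simp_all add: ip_simps)
  have zero: "pcontract G (d a) = 0" "pcontract F (d a) = 0"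
     "pcontract G (ip (Inr j) \<omega>) = 0" "pcontract F (ip (Inr j) \<omega>) = 0" for a j
    using ip0 by (intro pcontract_zero_bidegree; simp)+
  define B1 where "B1 = (\<Sum>k\<in>UNIV. wedge (coframe (Inr k)) (\<Sum>j\<in>UNIV. wedge (\<delta> k j) (ip (Inr j) \<omega>)))"
  define B2 where "B2 = (\<Sum>k\<in>UNIV. wedge (coframe (Inr k)) (pcontract L (d (Inr k))))"
  have B: "B = B1 + B2"
    by (simp add: B_def B1_def B2_def wedge_add_right sum.distrib)
  \<comment> \<open>The contraction hits either the leading coframe form or the derivative of
    \<omega>. The terms of the second kind form \<open>B2\<close> and cancel in
    \<open>B - pcontract L db\<close>.\<close>
  have L_db: "pcontract L db = (\<Sum>k\<in>UNIV. wedge (L (Inr k)) (d (Inr k))) + B2"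
    by (simp add: db_def B2_def pcontract_sum pcontract_wedge [OF L(1)] pcontract_coframe sum.distrib)
  have G_dl: "pcontract G dl = (\<Sum>i\<in>UNIV. wedge (G (Inl i)) (d (Inl i)))"
    by (simp add: dl_def pcontract_sum pcontract_wedge [OF vforms(1)] pcontract_coframe zero)
  have G_B1: "pcontract G B1 = (\<Sum>k\<in>UNIV. \<Sum>j\<in>UNIV. wedge (coframe (Inr k)) (wedge (pcontract G (\<delta> k j)) (ip (Inr j) \<omega>)))"
    by (simp add: B1_def pcontract_sum pcontract_wedge [OF vforms(1)] pcontract_coframe zero vforms wedge_sum_right)
  have G_L: "pcontract G (\<Sum>k\<in>UNIV. wedge (L (Inr k)) (d (Inr k))) = (\<Sum>k\<in>UNIV. wedge (pcontract G (L (Inr k))) (d (Inr k)))"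
    by (simp add: pcontract_sum pcontract_wedge [OF vforms(1)] zero)
  have H_db: "pcontract H db = (\<Sum>k\<in>UNIV. wedge (H (Inr k)) (d (Inr k))) + (\<Sum>k\<in>UNIV. wedge (coframe (Inr k)) (pcontract H (d (Inr k))))"
    by (simp add: db_def pcontract_sum pcontract_wedge [OF vforms(2)] pcontract_coframe sum.distrib)
  have F_dl: "pcontract F dl = (\<Sum>i\<in>UNIV. wedge (F (Inl i)) (d (Inl i)))"
    by (simp add: dl_def pcontract_sum pcontract_wedge [OF F(1)] pcontract_coframe zero)
  have F_B1: "pcontract F B1 = (\<Sum>k\<in>UNIV. \<Sum>j\<in>UNIV. wedge (coframe (Inr k)) (wedge (pcontract F (\<delta> k j)) (ip (Inr j) \<omega>)))"
    by (simp add: B1_def pcontract_sum pcontract_wedge [OF F(1)] pcontract_coframe zero F wedge_sum_right)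
  have F_B2: "pcontract F B2 = (\<Sum>k\<in>UNIV. wedge (coframe (Inr k)) (pcontract H (d (Inr k)))) - scale (of_nat q) db"
    by (simp add: B2_def db_def pcontract_sum pcontract_wedge [OF F(1)] pcontract_coframe F pcontract_F_L [OF d]
        wedge_diff_right wedge_scale_right sum_subtractf scale_sum)
  \<comment> \<open>The terms with \<open>pcontract H (d (Inr k))\<close> and the multiples of
    \<open>db\<close> cancel between \<open>H_db\<close>, \<open>F_B2\<close> and the summand with
    q. Every remaining summand contains a preimage supplied by \<open>pull_dz\<close> or
    \<open>pull_dzbar\<close>.\<close>
  have R: "R = (\<Sum>i\<in>UNIV. wedge (G (Inl i) - F (Inl i)) (d (Inl i)))
      + (\<Sum>k\<in>UNIV. wedge (H (Inr k) - pcontract G (L (Inr k))) (d (Inr k)))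
      + (\<Sum>k\<in>UNIV. \<Sum>j\<in>UNIV. wedge (coframe (Inr k)) (wedge (pcontract G (\<delta> k j) - pcontract F (\<delta> k j)) (ip (Inr j) \<omega>)))"
    unfolding R_def B L_db
    by (simp add: pcontract_simps G_dl G_B1 G_L H_db F_dl F_B1 F_B2 wedge_diff_left wedge_diff_right sum_subtractf)
  have one: "one_form (G (Inl i) - F (Inl i))" "one_form (H (Inr k) - pcontract G (L (Inr k)))"
    "one_form (pcontract G (\<delta> k j) - pcontract F (\<delta> k j))" for i j k
    by (auto intro!: one_form_intros vforms F one_form_sum simp: pcontract_one_form L \<delta>)
  show "alternating R"
    unfolding R by (intro alternating_add alternating_sum alternating_wedge_one_form one one_form_intros d alternating_ip \<omega>)
  have dz: "pull (frame K) (G (Inl i) - F (Inl i)) = coframe (Inl i)" for i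
    using pull_dz [of "coframe (Inl i)"] by (simp add: pcontract_coframe one_form_intros coframe_apply)
  show "pull (frame K) R = (\<Sum>a\<in>UNIV. wedge (coframe a) (pull (frame K) (d a)))
      + (\<Sum>j\<in>UNIV. wedge (\<Sum>k\<in>UNIV. wedge (pull (frame K) (coframe (Inr k))) (\<delta> k j)) (pull (frame K) (ip (Inr j) \<omega>)))"
    unfolding R pull_add pull_sum pull_wedge dz pull_dzbar pull_dz [OF \<delta>] sum_UNIV_Plus
    by (subst sum.swap) (simp only: wedge_sum_left wedge_assoc)
qed

end

section \<open>The differential of the extension map\<close>

definition form_conj :: "'n pform \<Rightarrow> 'n pform" where
  "form_conj \<alpha> = (\<lambda>l. cnj (\<alpha> (map bar l)))"

lemma bar_simps [simp]: "bar (Inl i) = Inr i" "bar (Inr i) = Inl i"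
  by (simp_all add: bar_def)

lemma bar_eq: "bar a = b \<longleftrightarrow> a = bar b"
  by (cases a; cases b; auto)

lemma pconj_eq_form_conj: "pconj K b = form_conj (K (bar b))"
  by (simp add: pconj_def form_conj_def)

lemma form_conj_wedge: "form_conj (wedge \<alpha> \<beta>) = wedge (form_conj \<alpha>) (form_conj \<beta>)"
  by (simp add: form_conj_def wedge_def nths_map)

lemma form_conj_sum: "form_conj (\<Sum>i\<in>I. f i) = (\<Sum>i\<in>I. form_conj (f i))"
  by (auto simp: form_conj_def sum_fun_apply fun_eq_iff)

lemma form_conj_coframe: "form_conj (coframe a) = coframe (bar a)"
proof
  show "form_conj (coframe a) l = coframe (bar a) l" for l
    using bar_eq by (cases l rule: remdups_adj.cases) (auto simp: form_conj_def coframe_def)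
qed

lemma differentiable_form_conj:
  "differentiable_form W z \<Longrightarrow> differentiable_form (\<lambda>y. form_conj (W y)) z"
  by (simp add: differentiable_form_def form_conj_def differentiable_cnj)

lemma form_deriv_conj:
  "differentiable_form W z \<Longrightarrow> form_deriv a (\<lambda>y. form_conj (W y)) z = form_conj (form_deriv (bar a) W z)"
  by (simp add: form_deriv_def form_conj_def fun_eq_iff differentiable_form_def wirtinger_cnj)

lemma form_deriv_cong:
  assumes "open S" "z \<in> S" "\<And>y. y \<in> S \<Longrightarrow> A y = B y"
  shows "form_deriv a A z = form_deriv a B z"
  unfolding form_deriv_def using assms by (intro ext wirtinger_cong [of S]) auto

text \<open>The formula on an open subset of complex n-space. The left side is expanded by
  \<open>form_deriv_pull\<close>, the right side by \<open>pull_rhs\<close>; integrability matches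
  the terms in which the conjugate of \<Phi> is differentiated.\<close>

lemma ext_deriv_pextend:
  fixes \<Phi> :: "complex ^ 'n::finite \<Rightarrow> 'n pvform" and W :: "complex ^ 'n \<Rightarrow> 'n pform"
  assumes S: "open S" "z \<in> S"
    and \<Phi>: "\<And>y. y \<in> S \<Longrightarrow> beltrami (\<Phi> y)" "\<And>b. differentiable_form (\<lambda>y. \<Phi> y b) z"
    and integrable: "\<And>j. (\<Sum>k\<in>UNIV. wedge (coframe (Inr k)) (form_deriv (Inr k) (\<lambda>y. \<Phi> y (Inl j)) z))
      = (\<Sum>i\<in>UNIV. wedge (\<Phi> z (Inl i)) (form_deriv (Inl i) (\<lambda>y. \<Phi> y (Inl j)) z))"
    and W: "\<And>y. y \<in> S \<Longrightarrow> alternating (W y)" "\<And>y. y \<in> S \<Longrightarrow> bidegree 0 q (W y)" "differentiable_form W z"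
    and inv: "invertible (mat10 (of_mat10 (mat 1) - (\<lambda>b. pcontract (pconj (\<Phi> z)) (\<Phi> z b))))"
      "invertible (mat01 (of_mat01 (mat 1) - (\<lambda>b. pcontract (\<Phi> z) (pconj (\<Phi> z) b))))"
  defines "G \<equiv> of_mat10 (matrix_inv (mat10 (of_mat10 (mat 1) - (\<lambda>b. pcontract (pconj (\<Phi> z)) (\<Phi> z b)))))"
    and "H \<equiv> of_mat01 (matrix_inv (mat01 (of_mat01 (mat 1) - (\<lambda>b. pcontract (\<Phi> z) (pconj (\<Phi> z) b)))))"
    and "dl \<equiv> \<Sum>i\<in>UNIV. wedge (coframe (Inl i)) (form_deriv (Inl i) W z)"
    and "db \<equiv> \<Sum>k\<in>UNIV. wedge (coframe (Inr k)) (form_deriv (Inr k) W z)"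
    and "B \<equiv> \<Sum>k\<in>UNIV. wedge (coframe (Inr k)) (form_deriv (Inr k) (\<lambda>y. pcontract (pconj (\<Phi> y)) (W y)) z)"
  shows "(\<Sum>a\<in>UNIV. wedge (coframe a) (form_deriv a (\<lambda>y. pextend (\<Phi> y) (W y)) z))
    = pextend (\<Phi> z) (pcontract G (dl + B - pcontract (pconj (\<Phi> z)) db) + pcontract H db
        - scale (of_nat q) db - pcontract (\<lambda>b. pcontract H (\<Phi> z b)) (dl + B))"
proof -
  define \<delta> where "\<delta> a j = form_deriv a (\<lambda>y. pconj (\<Phi> y) (Inr j)) z" for a j
  have K: "beltrami (\<Phi> z)"
    using S \<Phi> by blast
  have diff_conj: "differentiable_form (\<lambda>y. pconj (\<Phi> y) b) z" for b
    unfolding pconj_eq_form_conj by (intro differentiable_form_conj \<Phi>)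
  have \<delta>1: "one_form (\<delta> a j)" for a j
    unfolding \<delta>_def using S \<Phi> by (intro one_form_form_deriv [of S] beltramiD) auto
  have \<delta>2: "\<delta> a j [Inr m] = 0" for a j m
  proof -
    have "wirtinger a (\<lambda>y. pconj (\<Phi> y) (Inr j) [Inr m]) z = wirtinger a (\<lambda>y. 0) z"
      using S \<Phi> by (intro wirtinger_cong [of S]) (auto simp: beltramiD)
    then show ?thesis
      by (simp add: \<delta>_def form_deriv_def)
  qed
  \<comment> \<open>The conjugated integrability condition expresses the (1,0) derivatives of the
    conjugate of \<Phi> through its (0,1) derivatives. Added to the latter, this completes each
    \<open>coframe (Inr k)\<close> to its image under the frame map.\<close>
  have \<delta>_int: "(\<Sum>a\<in>UNIV. wedge (coframe a) (\<delta> a j))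
      = (\<Sum>k\<in>UNIV. wedge (pull (frame (\<Phi> z)) (coframe (Inr k))) (\<delta> (Inr k) j))" for j
  proof -
    have \<delta>: "\<delta> a j = form_conj (form_deriv (bar a) (\<lambda>y. \<Phi> y (Inl j)) z)" for a
      unfolding \<delta>_def pconj_eq_form_conj by (simp add: form_deriv_conj \<Phi>)
    have "(\<Sum>i\<in>UNIV. wedge (coframe (Inl i)) (\<delta> (Inl i) j))
        = (\<Sum>k\<in>UNIV. wedge (pconj (\<Phi> z) (Inr k)) (\<delta> (Inr k) j))"
      using arg_cong [OF integrable [of j], of form_conj]
      by (simp add: \<delta> form_conj_sum form_conj_wedge form_conj_coframe pconj_eq_form_conj)
    then show ?thesis
      by (simp add: sum_UNIV_Plus pull_frame_coframe [OF K] wedge_add_left sum.distrib add.commute)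
  qed
  have pc: "form_deriv (Inr k) (\<lambda>y. pcontract (pconj (\<Phi> y)) (W y)) z
    = (\<Sum>j\<in>UNIV. wedge (\<delta> (Inr k) j) (ip (Inr j) (W z))) + pcontract (pconj (\<Phi> z)) (form_deriv (Inr k) W z)" for k
  proof -
    have "form_deriv (Inr k) (\<lambda>y. pcontract (pconj (\<Phi> y)) (W y)) z
        = form_deriv (Inr k) (\<lambda>y. \<Sum>j\<in>UNIV. wedge (pconj (\<Phi> y) (Inr j)) (ip (Inr j) (W y))) z"
      using \<Phi>(1) by (intro form_deriv_cong [OF S]) (simp add: pcontract_def sum_UNIV_Plus beltramiD)
    also have "\<dots> = (\<Sum>j\<in>UNIV. wedge (\<delta> (Inr k) j) (ip (Inr j) (W z))
        + wedge (pconj (\<Phi> z) (Inr j)) (ip (Inr j) (form_deriv (Inr k) W z)))"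
      by (simp add: form_deriv_sum form_deriv_wedge differentiable_form_wedge diff_conj differentiable_form_ip W
          form_deriv_ip \<delta>_def)
    also have "\<dots> = (\<Sum>j\<in>UNIV. wedge (\<delta> (Inr k) j) (ip (Inr j) (W z))) + pcontract (pconj (\<Phi> z)) (form_deriv (Inr k) W z)"
      by (simp add: pcontract_def sum_UNIV_Plus beltramiD [OF K] sum.distrib)
    finally show ?thesis .
  qed
  have lhs: "form_deriv a (\<lambda>y. pextend (\<Phi> y) (W y)) z = pull (frame (\<Phi> z)) (form_deriv a W z)
      + (\<Sum>j\<in>UNIV. wedge (\<delta> a j) (pull (frame (\<Phi> z)) (ip (Inr j) (W z))))" for a
  proof -
    have df: "(\<lambda>y. frame (\<Phi> y) c b) differentiable (at z)" for c b
      using \<Phi>(2) [of c] diff_conj [of c] unfolding frame_def differentiable_form_def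
      by (intro differentiable_add) auto
    let ?\<Theta> = "\<lambda>c l. case l of [b] \<Rightarrow> wirtinger a (\<lambda>y. frame (\<Phi> y) c b) z | _ \<Rightarrow> 0"
    \<comment> \<open>On a (0,q)-form only the rows \<open>Inr j\<close> of the frame matrix
      contribute, and there \<open>\<Phi> y (Inr j)\<close> is 0, so that just the conjugate is
      differentiated.\<close>
    have \<Theta>: "?\<Theta> (Inr j) = \<delta> a j" for j
    proof (rule one_form_eqI)
      show "one_form (?\<Theta> (Inr j))"
        by (auto simp: one_form_def split: list.split)
      have "wirtinger a (\<lambda>y. frame (\<Phi> y) (Inr j) b) z = wirtinger a (\<lambda>y. coframe (Inr j) [b] + pconj (\<Phi> y) (Inr j) [b]) z" for b
        using \<Phi>(1) by (intro wirtinger_cong [OF S]) (simp add: frame_def beltramiD pointwise)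
      also have "\<dots> b = \<delta> a j [b]" for b
        using diff_conj [of "Inr j"] by (subst wirtinger_add) (auto simp: differentiable_form_def \<delta>_def form_deriv_def)
      finally show "?\<Theta> (Inr j) [b] = \<delta> a j [b]" for b
        by simp
    qed (rule \<delta>1)
    have "form_deriv a (\<lambda>y. pextend (\<Phi> y) (W y)) z = form_deriv a (\<lambda>y. pull (frame (\<Phi> y)) (W y)) z"
      using \<Phi>(1) W(1) by (intro form_deriv_cong [OF S] pextend_eq_pull)
    also have "\<dots> = pull (frame (\<Phi> z)) (form_deriv a W z) + (\<Sum>c\<in>UNIV. wedge (?\<Theta> c) (pull (frame (\<Phi> z)) (ip c (W z))))"
      using W S by (intro form_deriv_pull df) auto
    also have "(\<Sum>c\<in>UNIV. wedge (?\<Theta> c) (pull (frame (\<Phi> z)) (ip c (W z))))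
      = (\<Sum>j\<in>UNIV. wedge (\<delta> a j) (pull (frame (\<Phi> z)) (ip (Inr j) (W z))))"
      unfolding sum_UNIV_Plus \<Theta> by (simp add: ip_Inl_bidegree_0 [OF W(2) [OF S(2)]] pull_zero)
    finally show ?thesis .
  qed
  have B: "B = (\<Sum>k\<in>UNIV. wedge (coframe (Inr k)) ((\<Sum>j\<in>UNIV. wedge (\<delta> (Inr k) j) (ip (Inr j) (W z)))
      + pcontract (pconj (\<Phi> z)) (form_deriv (Inr k) W z)))"
    by (simp add: B_def pc)
  let ?R = "pcontract G (dl + B - pcontract (pconj (\<Phi> z)) db) + pcontract H db
        - scale (of_nat q) db - pcontract (\<lambda>b. pcontract H (\<Phi> z b)) (dl + B)"
  have alt: "alternating ?R" and rhs: "pull (frame (\<Phi> z)) ?R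
    = (\<Sum>a\<in>UNIV. wedge (coframe a) (pull (frame (\<Phi> z)) (form_deriv a W z)))
      + (\<Sum>j\<in>UNIV. wedge (\<Sum>k\<in>UNIV. wedge (pull (frame (\<Phi> z)) (coframe (Inr k))) (\<delta> (Inr k) j))
          (pull (frame (\<Phi> z)) (ip (Inr j) (W z))))"
    unfolding B dl_def db_def G_def H_def
    by (rule pull_rhs [OF K inv W(1) [OF S(2)] W(2) [OF S(2)] alternating_form_deriv [OF S W(1,3)]
          bidegree_form_deriv [OF S W(2)] \<delta>1 \<delta>2]; assumption)+
  have "(\<Sum>a\<in>UNIV. wedge (coframe a) (form_deriv a (\<lambda>y. pextend (\<Phi> y) (W y)) z))
    = (\<Sum>a\<in>UNIV. wedge (coframe a) (pull (frame (\<Phi> z)) (form_deriv a W z)))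
      + (\<Sum>j\<in>UNIV. wedge (\<Sum>a\<in>UNIV. wedge (coframe a) (\<delta> a j)) (pull (frame (\<Phi> z)) (ip (Inr j) (W z))))"
    unfolding lhs wedge_add_right sum.distrib wedge_sum_right wedge_sum_left wedge_assoc
    by (subst sum.swap) (rule refl)
  also have "\<dots> = pull (frame (\<Phi> z)) ?R"
    unfolding \<delta>_int rhs ..
  also have "\<dots> = pextend (\<Phi> z) ?R"
    by (rule pextend_eq_pull [OF K alt, symmetric])
  finally show ?thesis .
qed

section \<open>Transfer to the charts of the central fibre\<close>

lemma coeff_deriv_eq_form_deriv:
  "coeff_deriv a \<alpha> (U, \<psi>) x = form_deriv a (\<lambda>y. \<alpha> (U, \<psi>) (inv_into U \<psi> y)) (\<psi> x)"
  by (simp add: coeff_deriv_def chart_deriv_def form_deriv_def)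

lemma is_chart_fibre_atlas: "c \<in> fibre_atlas T A \<pi> t \<Longrightarrow> is_chart (fibre T \<pi> t) c"
  by (simp add: fibre_atlas_def max_atlas_def)

lemma is_chart_inj_on:
  assumes "is_chart T (U, \<psi>)"
  shows "inj_on \<psi> U"
proof -
  have "topspace (subtopology T U) = U"
    using assms openin_subset by (fastforce simp: is_chart_def)
  then show ?thesis
    using assms by (auto simp: is_chart_def homeomorphic_map_def dest: homeomorphic_imp_injective_map)
qed

lemma smooth_in_chart_differentiable:
  assumes "smooth_in_chart (U, \<psi>) g" "z \<in> \<psi> ` U"
  shows "(\<lambda>y. g (inv_into U \<psi> y)) differentiable (at z)"
proof -
  have "Ck_on (Suc 0) (\<lambda>y. g (inv_into U \<psi> y)) (\<psi> ` U)"
    using assms by (simp add: smooth_in_chart_def smooth_on_def del: Ck_on.simps)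
  then show ?thesis
    using assms(2) unfolding Ck_on.simps by blast
qed

theorem corollary1p7:
  fixes T :: "'a topology"
    and A :: "('a, 'n::finite option) chart set"
    and \<pi> :: "'a \<Rightarrow> complex"
    and r :: real
    and \<sigma> :: "'a \<Rightarrow> 'a"
    and \<phi> :: "complex \<Rightarrow> ('a, 'n) vform"
    and t :: complex
    and q :: nat
    and \<omega> :: "('a, 'n) form"
  assumes "holomorphic_family T A \<pi> r"
    and "transversely_holomorphic_trivialization T A \<pi> r \<sigma>"
    and "kuranishi_data T A \<pi> r \<sigma> \<phi>"
    and "t \<in> ball 0 r"
    and "inverses_exist (fibre_atlas T A \<pi> 0) (\<phi> t)"
    and "\<omega> \<in> forms (fibre_atlas T A \<pi> 0) 0 q"
  shows "eq_on_atlas (fibre_atlas T A \<pi> 0)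
    (ext_deriv (extend (\<phi> t) \<omega>))
    (extend (\<phi> t)
      (inverse10 (id10 - \<phi> t \<bullet>\<^sub>v vconj (\<phi> t)) \<rightharpoondown>
          (del \<omega> + delbar (vconj (\<phi> t) \<rightharpoondown> \<omega>) - vconj (\<phi> t) \<rightharpoondown> delbar \<omega>)
       + inverse01 (id01 - vconj (\<phi> t) \<bullet>\<^sub>v \<phi> t) \<rightharpoondown> delbar \<omega>
       - form_scale (of_nat q) (delbar \<omega>)
       - (inverse01 (id01 - vconj (\<phi> t) \<bullet>\<^sub>v \<phi> t) \<rightharpoondown>\<^sub>v \<phi> t) \<rightharpoondown>
          (del \<omega> + delbar (vconj (\<phi> t) \<rightharpoondown> \<omega>))))"
proof -
  let ?A0 = "fibre_atlas T A \<pi> 0" and ?\<phi> = "\<phi> t"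
  have \<phi>: "?\<phi> \<in> vforms10 ?A0 0 1"
    and integrable: "eq_on_atlas ?A0 (vdelbar ?\<phi>) (\<lambda>c x b l. 1 / 2 * bracket ?\<phi> ?\<phi> c x b l)"
    using assms(3,4) by (auto simp: kuranishi_data_def Let_def)
  from \<phi> have \<phi>_bidegree: "\<forall>c\<in>?A0. \<forall>x\<in>fst c. \<forall>b. bidegree 0 1 (?\<phi> c x b)"
    and \<phi>_Inr: "\<forall>c\<in>?A0. \<forall>x\<in>fst c. \<forall>i l. ?\<phi> c x (Inr i) l = 0"
    and \<phi>_smooth: "\<forall>c\<in>?A0. \<forall>b l. smooth_in_chart c (\<lambda>x. ?\<phi> c x b l)"
    unfolding vforms10_def by blast+
  from assms(6) have \<omega>_form: "\<forall>c\<in>?A0. \<forall>x\<in>fst c. alternating (\<omega> c x) \<and> bidegree 0 q (\<omega> c x)"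
    and \<omega>_smooth: "\<forall>c\<in>?A0. \<forall>l. smooth_in_chart c (\<lambda>x. \<omega> c x l)"
    unfolding forms_def by blast+
  \<comment> \<open>Both sides are compared at a point of a chart. Read through the chart, the
    coefficients are functions on its open image, where the formula in coordinates applies.\<close>
  show ?thesis
    unfolding eq_on_atlas_def
  proof (clarify)
    fix U \<psi> x
    assume c: "(U, \<psi>) \<in> ?A0" and x: "x \<in> U"
    define g where "g = inv_into U \<psi>"
    have inj: "inj_on \<psi> U" and S: "open (\<psi> ` U)" "\<psi> x \<in> \<psi> ` U"
      using is_chart_inj_on is_chart_fibre_atlas [OF c] x by (auto simp: is_chart_def)
    have gU: "g y \<in> U" if "y \<in> \<psi> ` U" for y
      using that by (simp add: g_def inv_into_into)
    have gx: "g (\<psi> x) = x"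
      using inj x by (simp add: g_def)
    note deriv = coeff_deriv_eq_form_deriv [of _ _ U \<psi> x, folded g_def]
    have beltrami: "beltrami (?\<phi> (U, \<psi>) (g y))" if "y \<in> \<psi> ` U" for y
      using \<phi>_bidegree \<phi>_Inr c gU [OF that] unfolding beltrami_def by (fastforce simp: fun_eq_iff zero_fun_apply)
    have diff_\<phi>: "differentiable_form (\<lambda>y. ?\<phi> (U, \<psi>) (g y) b) (\<psi> x)" for b
      unfolding differentiable_form_def g_def using \<phi>_smooth c by (intro allI smooth_in_chart_differentiable S) blast
    have \<omega>: "alternating (\<omega> (U, \<psi>) (g y))" "bidegree 0 q (\<omega> (U, \<psi>) (g y))" if "y \<in> \<psi> ` U" for y
      using \<omega>_form c gU [OF that] by force+
    have diff_\<omega>: "differentiable_form (\<lambda>y. \<omega> (U, \<psi>) (g y)) (\<psi> x)"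
      unfolding differentiable_form_def g_def using \<omega>_smooth c by (intro allI smooth_in_chart_differentiable S) blast
    have inv: "invertible (mat10 (of_mat10 (mat 1) - (\<lambda>b. pcontract (pconj (?\<phi> (U, \<psi>) x)) (?\<phi> (U, \<psi>) x b))))"
      "invertible (mat01 (of_mat01 (mat 1) - (\<lambda>b. pcontract (?\<phi> (U, \<psi>) x) (pconj (?\<phi> (U, \<psi>) x) b))))"
      using assms(5) c x by (force simp: inverses_exist_def id10_def id01_def vprod_def vcontract_def vconj_def)+
    \<comment> \<open>In the bracket of \<phi> with itself the two summands coincide, which absorbs
      the factor 1/2.\<close>
    have int: "(\<Sum>k\<in>UNIV. wedge (coframe (Inr k)) (form_deriv (Inr k) (\<lambda>y. ?\<phi> (U, \<psi>) (g y) (Inl j)) (\<psi> x)))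
      = (\<Sum>i\<in>UNIV. wedge (?\<phi> (U, \<psi>) x (Inl i)) (form_deriv (Inl i) (\<lambda>y. ?\<phi> (U, \<psi>) (g y) (Inl j)) (\<psi> x)))" for j
    proof -
      have "vdelbar ?\<phi> (U, \<psi>) x (Inl j) l = 1 / 2 * bracket ?\<phi> ?\<phi> (U, \<psi>) x (Inl j) l" for l
        using integrable c x by (auto simp: eq_on_atlas_def)
      then show ?thesis
        by (simp add: vdelbar_def delbar_def bracket_def deriv fun_eq_iff plus_fun_apply sum_fun_apply
            flip: sum_distrib_left)
    qed
    show "ext_deriv (extend ?\<phi> \<omega>) (U, \<psi>) x =
       extend ?\<phi>
        (inverse10 (id10 - ?\<phi> \<bullet>\<^sub>v vconj ?\<phi>) \<rightharpoondown>
          (del \<omega> + delbar (vconj ?\<phi> \<rightharpoondown> \<omega>) - vconj ?\<phi> \<rightharpoondown> delbar \<omega>)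
         + inverse01 (id01 - vconj ?\<phi> \<bullet>\<^sub>v ?\<phi>) \<rightharpoondown> delbar \<omega>
         - form_scale (of_nat q) (delbar \<omega>)
         - (inverse01 (id01 - vconj ?\<phi> \<bullet>\<^sub>v ?\<phi>) \<rightharpoondown>\<^sub>v ?\<phi>) \<rightharpoondown>
           (del \<omega> + delbar (vconj ?\<phi> \<rightharpoondown> \<omega>))) (U, \<psi>) x"
      \<comment> \<open>The open set is the image of the chart, and \<open>gx\<close> replaces the
        preimage of the image point by \<open>x\<close>; then both sides agree after
        unfolding.\<close>
      using ext_deriv_pextend [where \<Phi> = "\<lambda>y. ?\<phi> (U, \<psi>) (g y)" and W = "\<lambda>y. \<omega> (U, \<psi>) (g y)" and q = q,
          OF S beltrami diff_\<phi> _ \<omega> diff_\<omega>, unfolded gx, OF _ int _ _ inv]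
      by (simp add: ext_deriv_def extend_def contract_def vcontract_def vconj_def vprod_def inverse10_def inverse01_def
          id10_def id01_def del_def delbar_def deriv gx form_scale_def plus_fun_apply fun_diff_def
          flip: scale_def)
  qed
qed

end
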